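(* Let $k\in\{2,3\}$, $0<\theta<\theta_c(k)$ and $\lambda>\lambda_{\rm cr}(k)$, where $\theta_c(2)=1/3$, $\lambda_{\rm cr}(2)=\frac{9}{4(1-3\theta)}$, $\theta_c(3)=1/2$, $\lambda_{\rm cr}(3)=\frac{1}{2-4\theta}(\frac43)^3$. Then the two TISGMs $\mu_1^*$ and $\mu_2^*$ of the SCWR model corresponding to the non-symmetric solutions $(x_1^*,x_2^* )$ and $(x_2^*,x_1^* )$ are extreme points of the (convex) set of all Gibbs measures of the model.
   Context: SCWR model on the Cayley tree $\mathbb{T}^k$ with spins $\{-1,0,1\}$, activity $\lambda$, $\theta=e^{-J\beta}\in(0,1)$ (ferromagnetic); Gibbs measures are probability measures on $\{-1,0,1\}^{\mathbb{T}^k}$ consistent with the specification given by the Hamiltonian $J\sum_{\{i,j\}}\mathbf{1}(\omega_i\omega_j=-1)-\frac{\ln\lambda}{\beta}\sum_i\omega_i^2$ at inverse temperature $\beta$; a Gibbs measure is extreme if it is not a nontrivial convex combination of other Gibbs measures. TISGMs correspond one-to-one to positive solutions $(x,y)$ of $x=\lambda\bigl(\frac{1+x+\theta y}{1+x+y}\bigr)^k$, $y=\lambda\bigl(\frac{1+\theta x+y}{1+x+y}\bigr)^k$; under the stated hypotheses there are exactly three such solutions $(x^*,x^* )$, $(x_1^*,x_2^* )$, $(x_2^*,x_1^* )$ with $x_1^*<x_2^*$. *)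

theory Defs
  imports "HOL-Probability.Probability"
begin

(* Cayley tree T^k: vertices are lists of naturals; [] is the root, the children of
   the root are [c] with c \<le> k (k+1 of them), the children of a non-root vertex v
   are c # v with c < k (k of them).  Every vertex has degree k+1. *)
definition tree_vertex :: "nat \<Rightarrow> nat list \<Rightarrow> bool" where
  "tree_vertex k v \<longleftrightarrow> v = [] \<or> (last v \<le> k \<and> (\<forall>i\<in>set (butlast v). i < k))"

definition cayley_V :: "nat \<Rightarrow> nat list set" where
  "cayley_V k = {v. tree_vertex k v}"

(* each (unordered) edge is listed once, as (parent, child) *)
definition cayley_E :: "nat \<Rightarrow> (nat list \<times> nat list) set" where
  "cayley_E k = {(u, w). u \<in> cayley_V k \<and> w \<in> cayley_V k \<and> (\<exists>c. w = c # u)}"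

definition spins :: "int set" where
  "spins = {-1, 0, 1}"

definition config_space :: "nat \<Rightarrow> (nat list \<Rightarrow> int) measure" where
  "config_space k = PiM (cayley_V k) (\<lambda>_. count_space spins)"

(* exp(-beta J 1(s t = -1)) with theta = exp(-J beta) *)
definition inter_w :: "real \<Rightarrow> int \<Rightarrow> int \<Rightarrow> real" where
  "inter_w \<theta> s t = (if s * t = -1 then \<theta> else 1)"

(* exp(ln lambda * s^2) = lambda^(s^2) *)
definition act_w :: "real \<Rightarrow> int \<Rightarrow> real" where
  "act_w lam s = lam ^ nat (s * s)"

definition merge_cfg :: "nat list set \<Rightarrow> (nat list \<Rightarrow> int) \<Rightarrow> (nat list \<Rightarrow> int) \<Rightarrow> (nat list \<Rightarrow> int)" where
  "merge_cfg \<Lambda> \<sigma> \<omega> = (\<lambda>v. if v \<in> \<Lambda> then \<sigma> v else \<omega> v)"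

(* Boltzmann weight exp(-beta H_Lambda(eta)) of the SCWR Hamiltonian in volume Lambda *)
definition spec_weight :: "nat \<Rightarrow> real \<Rightarrow> real \<Rightarrow> nat list set \<Rightarrow> (nat list \<Rightarrow> int) \<Rightarrow> real" where
  "spec_weight k \<theta> lam \<Lambda> \<eta> =
     (\<Prod>e\<in>{e\<in>cayley_E k. fst e \<in> \<Lambda> \<or> snd e \<in> \<Lambda>}. inter_w \<theta> (\<eta> (fst e)) (\<eta> (snd e)))
   * (\<Prod>v\<in>\<Lambda>. act_w lam (\<eta> v))"

definition spec_kernel :: "nat \<Rightarrow> real \<Rightarrow> real \<Rightarrow> nat list set \<Rightarrow> (nat list \<Rightarrow> int) set
     \<Rightarrow> (nat list \<Rightarrow> int) \<Rightarrow> real" where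
  "spec_kernel k \<theta> lam \<Lambda> A \<omega> =
     (\<Sum>\<sigma>\<in>PiE \<Lambda> (\<lambda>_. spins). spec_weight k \<theta> lam \<Lambda> (merge_cfg \<Lambda> \<sigma> \<omega>) * indicator A (merge_cfg \<Lambda> \<sigma> \<omega>))
   / (\<Sum>\<sigma>\<in>PiE \<Lambda> (\<lambda>_. spins). spec_weight k \<theta> lam \<Lambda> (merge_cfg \<Lambda> \<sigma> \<omega>))"

definition outer_sets :: "nat \<Rightarrow> nat list set \<Rightarrow> (nat list \<Rightarrow> int) set set" where
  "outer_sets k \<Lambda> = sets (vimage_algebra (space (config_space k))
      (\<lambda>\<omega>. restrict \<omega> (cayley_V k - \<Lambda>)) (PiM (cayley_V k - \<Lambda>) (\<lambda>_. count_space spins)))"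

definition is_gibbs :: "nat \<Rightarrow> real \<Rightarrow> real \<Rightarrow> (nat list \<Rightarrow> int) measure \<Rightarrow> bool" where
  "is_gibbs k \<theta> lam \<mu> \<longleftrightarrow> prob_space \<mu> \<and> sets \<mu> = sets (config_space k) \<and>
     (\<forall>\<Lambda>. finite \<Lambda> \<and> \<Lambda> \<subseteq> cayley_V k \<longrightarrow>
        (\<forall>A\<in>sets (config_space k). \<forall>B\<in>outer_sets k \<Lambda>.
           measure \<mu> (A \<inter> B) = set_lebesgue_integral \<mu> B (spec_kernel k \<theta> lam \<Lambda> A)))"

definition extreme_gibbs :: "nat \<Rightarrow> real \<Rightarrow> real \<Rightarrow> (nat list \<Rightarrow> int) measure \<Rightarrow> bool" where
  "extreme_gibbs k \<theta> lam \<mu> \<longleftrightarrow> is_gibbs k \<theta> lam \<mu> \<and>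
     (\<forall>\<mu>1 \<mu>2 (t::real). is_gibbs k \<theta> lam \<mu>1 \<and> is_gibbs k \<theta> lam \<mu>2 \<and> 0 < t \<and> t < 1 \<and>
        (\<forall>A\<in>sets (config_space k). measure \<mu> A = t * measure \<mu>1 A + (1 - t) * measure \<mu>2 A)
        \<longrightarrow> \<mu>1 = \<mu> \<and> \<mu>2 = \<mu>)"

(* TISGM given by the boundary law z_1 = x, z_{-1} = y, z_0 = 1 *)
definition ball_n :: "nat \<Rightarrow> nat \<Rightarrow> nat list set" where
  "ball_n k n = {v \<in> cayley_V k. length v \<le> n}"

definition bl :: "real \<Rightarrow> real \<Rightarrow> int \<Rightarrow> real" where
  "bl x y s = (if s = 1 then x else if s = -1 then y else 1)"

definition tisgm_weight :: "nat \<Rightarrow> real \<Rightarrow> real \<Rightarrow> real \<Rightarrow> real \<Rightarrow> nat \<Rightarrow> (nat list \<Rightarrow> int) \<Rightarrow> real" where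
  "tisgm_weight k \<theta> lam x y n \<sigma> =
     (\<Prod>e\<in>{e\<in>cayley_E k. length (snd e) \<le> n}. inter_w \<theta> (\<sigma> (fst e)) (\<sigma> (snd e)))
   * (\<Prod>v\<in>{v\<in>cayley_V k. length v < n}. act_w lam (\<sigma> v))
   * (\<Prod>v\<in>{v\<in>cayley_V k. length v = n}. bl x y (\<sigma> v))"

definition tisgm_of :: "nat \<Rightarrow> real \<Rightarrow> real \<Rightarrow> real \<Rightarrow> real \<Rightarrow> (nat list \<Rightarrow> int) measure \<Rightarrow> bool" where
  "tisgm_of k \<theta> lam x y \<mu> \<longleftrightarrow> prob_space \<mu> \<and> sets \<mu> = sets (config_space k) \<and>
     (\<forall>n\<ge>1. \<forall>\<sigma>\<in>PiE (ball_n k n) (\<lambda>_. spins).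
        measure \<mu> {\<omega>\<in>space (config_space k). \<forall>v\<in>ball_n k n. \<omega> v = \<sigma> v}
        = tisgm_weight k \<theta> lam x y n \<sigma> / (\<Sum>\<tau>\<in>PiE (ball_n k n) (\<lambda>_. spins). tisgm_weight k \<theta> lam x y n \<tau>))"

definition theta_c :: "nat \<Rightarrow> real" where
  "theta_c k = (if k = 2 then 1/3 else 1/2)"

definition lambda_cr :: "nat \<Rightarrow> real \<Rightarrow> real" where
  "lambda_cr k \<theta> = (if k = 2 then 9 / (4 * (1 - 3 * \<theta>)) else (1 / (2 - 4 * \<theta>)) * (4/3)^3)"

end

theory Submission
  imports Defs
begin

text \<open>
  The interaction is attractive for the order \<open>-1 < 0 < 1\<close>, so for every increasing local event the
  conditional probability given a boundary condition is largest for the all-plus boundary. On the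
  tree this is seen by summing out the leaves level by level: messages ordered by monotone
  likelihood ratio stay ordered. The all-plus boundary produces messages that decrease to the
  largest solution of the boundary law equation. The asymmetric solution with \<open>x > y\<close> is unique,
  hence it is this largest one, and its measure dominates every Gibbs measure on increasing events.
  If \<open>\<mu> = t \<mu>1 + (1 - t) \<mu>2\<close>, domination forces equality on increasing events, and these determine a
  measure. The case \<open>x < y\<close> is the same with the order reversed.
\<close>

section \<open>The tree\<close>

text \<open>A vertex multiplies the messages of its children, and products preserve the likelihood
  ratio order but not stochastic domination; hence the stronger order. No coupling is constructed.
  Domination is proved only for events with one threshold per vertex: their indicators factor over
  the vertices, so they pass through the leaf summation as extra single-site factors, and they still
  determine a measure. The uniqueness of the asymmetric solution is where k in {2, 3} matters: s = u
  + v then solves an explicit equation f(s) = 1 / lam with f strictly increasing on the relevant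
  range. The root has k + 1 children and every other vertex has k, so the homogeneous recursion is
  run only down to balls of radius at least 1. Since \<open>tisgm_of\<close> fixes just the
  marginals on balls, the Gibbs property, which extremality includes, gets its own proof.\<close>

definition children :: "nat \<Rightarrow> nat list \<Rightarrow> nat list set" where
  "children k v = {w \<in> cayley_V k. w \<noteq> [] \<and> tl w = v}"

definition level :: "nat \<Rightarrow> nat \<Rightarrow> nat list set" where
  "level k n = {v \<in> cayley_V k. length v = n}"

lemma tree_vertex_Cons:
  "tree_vertex k (c # u) \<longleftrightarrow> tree_vertex k u \<and> (if u = [] then c \<le> k else c < k)"
  by (auto simp: tree_vertex_def)

lemma Nil_in_cayley_V [simp]: "[] \<in> cayley_V k"
  by (simp add: cayley_V_def tree_vertex_def)

lemma Nil_in_ball_n [simp]: "[] \<in> ball_n k n"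
  by (simp add: ball_n_def)

lemma tl_in_cayley_V: "w \<in> cayley_V k \<Longrightarrow> tl w \<in> cayley_V k"
  by (cases w) (auto simp: cayley_V_def tree_vertex_Cons)

lemma set_tree_vertex: "tree_vertex k v \<Longrightarrow> set v \<subseteq> {..k}"
  by (induction v) (auto simp: tree_vertex_Cons split: if_splits)

lemma finite_ball_n [simp]: "finite (ball_n k n)"
proof (rule finite_subset)
  show "ball_n k n \<subseteq> {xs. set xs \<subseteq> {..k} \<and> length xs \<le> n}"
    using set_tree_vertex by (auto simp: ball_n_def cayley_V_def)
qed (simp add: finite_lists_length_le)

lemma finite_level [simp]: "finite (level k n)"
  by (rule finite_subset[OF _ finite_ball_n[of k n]]) (auto simp: level_def ball_n_def)

lemma children_eq:
  assumes "v \<in> cayley_V k" "v \<noteq> []"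
  shows "children k v = (\<lambda>c. c # v) ` {..<k}"
proof -
  have "w \<in> (\<lambda>c. c # v) ` {..<k}" if "w \<in> children k v" for w
    using that assms by (cases w) (auto simp: children_def cayley_V_def tree_vertex_Cons)
  then show ?thesis
    using assms by (auto simp: children_def cayley_V_def tree_vertex_Cons)
qed

text \<open>The root is excluded because it has k + 1 children; this is the origin of the conditions
  \<open>1 \<le> N\<close> further down.\<close>

lemma card_children: "v \<in> cayley_V k \<Longrightarrow> v \<noteq> [] \<Longrightarrow> card (children k v) = k"
  by (simp add: children_eq card_image inj_on_def)

lemma ball_n_Suc: "ball_n k (Suc n) = ball_n k n \<union> level k (Suc n)"
  by (auto simp: ball_n_def level_def)

lemma ball_n_level_disjoint: "ball_n k n \<inter> level k (Suc n) = {}"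
  by (auto simp: ball_n_def level_def)

lemma ball_n_0: "ball_n k 0 = {[]}"
  by (auto simp: ball_n_def)

lemma ball_n_mono: "m \<le> n \<Longrightarrow> ball_n k m \<subseteq> ball_n k n"
  by (auto simp: ball_n_def)

lemma ball_n_subset: "ball_n k n \<subseteq> cayley_V k"
  by (auto simp: ball_n_def)

lemma exhausting_ball:
  assumes "finite L" "L \<subseteq> cayley_V k"
  obtains n where "L \<subseteq> ball_n k n"
proof
  show "L \<subseteq> ball_n k (Max (length ` L))"
    using assms by (auto simp: ball_n_def)
qed

text \<open>A non-root vertex w has the single parent \<open>tl w\<close>, so edges can be indexed
  by their child endpoints. The free predicate P covers both edge sets that occur: edges meeting
  \<Lambda> and edges inside a ball.\<close>

lemma prod_edges:
  fixes f :: "_ \<Rightarrow> real"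
  shows "(\<Prod>e\<in>{e \<in> cayley_E k. P (fst e) (snd e)}. f e) =
    (\<Prod>w\<in>{w \<in> cayley_V k. w \<noteq> [] \<and> P (tl w) w}. f (tl w, w))"
proof (rule prod.reindex_cong[where l = "\<lambda>w. (tl w, w)"])
  show "{e \<in> cayley_E k. P (fst e) (snd e)} =
      (\<lambda>w. (tl w, w)) ` {w \<in> cayley_V k. w \<noteq> [] \<and> P (tl w) w}"
  proof (intro set_eqI iffI)
    fix e assume "e \<in> (\<lambda>w. (tl w, w)) ` {w \<in> cayley_V k. w \<noteq> [] \<and> P (tl w) w}"
    then obtain w where w: "e = (tl w, w)" "w \<in> cayley_V k" "w \<noteq> []" "P (tl w) w" by auto
    then show "e \<in> {e \<in> cayley_E k. P (fst e) (snd e)}"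
      using tl_in_cayley_V[of w k] by (cases w) (auto simp: cayley_E_def)
  qed (auto simp: cayley_E_def image_iff)
qed (auto simp: inj_on_def)

lemma prod_level_Suc:
  fixes f :: "_ \<Rightarrow> real"
  shows "(\<Prod>w\<in>level k (Suc n). f w) = (\<Prod>v\<in>level k n. \<Prod>w\<in>children k v. f w)"
proof -
  have "(\<Prod>v\<in>level k n. \<Prod>w\<in>children k v. f w) =
      (\<Prod>v\<in>level k n. prod f {w \<in> level k (Suc n). tl w = v})"
    by (intro prod.cong) (auto simp: level_def children_def)
  also have "\<dots> = (\<Prod>w\<in>level k (Suc n). f w)"
    by (rule prod.group) (simp, simp, auto simp: level_def tl_in_cayley_V)
  finally show ?thesis by simp
qed

text \<open>Merging and the pair of restrictions are mutually inverse. A merged function stays in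
  \<open>PiE\<close> because \<tau> is already \<open>undefined\<close> outside B.\<close>

lemma sum_PiE_Un:
  fixes f :: "_ \<Rightarrow> real"
  assumes "A \<inter> B = {}"
  shows "(\<Sum>\<rho>\<in>PiE (A \<union> B) (\<lambda>_. S). f \<rho>) =
    (\<Sum>\<sigma>\<in>PiE A (\<lambda>_. S). \<Sum>\<tau>\<in>PiE B (\<lambda>_. S). f (merge_cfg A \<sigma> \<tau>))"
proof -
  have "(\<Sum>\<rho>\<in>PiE (A \<union> B) (\<lambda>_. S). f \<rho>) =
      (\<Sum>p\<in>PiE A (\<lambda>_. S) \<times> PiE B (\<lambda>_. S). f (merge_cfg A (fst p) (snd p)))"
    by (rule sum.reindex_bij_witness[where i = "\<lambda>p. merge_cfg A (fst p) (snd p)"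
          and j = "\<lambda>\<rho>. (restrict \<rho> A, restrict \<rho> B)"])
      (use assms in \<open>auto simp: merge_cfg_def PiE_def Pi_def extensional_def fun_eq_iff
         restrict_def intro!: arg_cong[of _ _ f]\<close>)
  then show ?thesis
    by (simp add: sum.cartesian_product case_prod_beta)
qed

section \<open>Tree partition functions\<close>

text \<open>The site factors \<phi> may vary with the vertex, so that activities, boundary laws,
  boundary conditions and indicators of events all fit one format.\<close>

definition tree_weight :: "nat \<Rightarrow> real \<Rightarrow> nat \<Rightarrow> (nat list \<Rightarrow> int \<Rightarrow> real) \<Rightarrow> (nat list \<Rightarrow> int) \<Rightarrow> real" where
  "tree_weight k \<theta> n \<phi> \<sigma> = (\<Prod>w\<in>ball_n k n - {[]}. inter_w \<theta> (\<sigma> (tl w)) (\<sigma> w)) *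
     (\<Prod>v\<in>ball_n k n. \<phi> v (\<sigma> v))"

definition tree_Z :: "nat \<Rightarrow> real \<Rightarrow> nat \<Rightarrow> (nat list \<Rightarrow> int \<Rightarrow> real) \<Rightarrow> real" where
  "tree_Z k \<theta> n \<phi> = (\<Sum>\<sigma>\<in>PiE (ball_n k n) (\<lambda>_. spins). tree_weight k \<theta> n \<phi> \<sigma>)"

text \<open>The sum-product message of belief propagation, sent by a child with site factor f to a
  parent with spin s.\<close>

definition msg :: "real \<Rightarrow> (int \<Rightarrow> real) \<Rightarrow> int \<Rightarrow> real" where
  "msg \<theta> f s = (\<Sum>t\<in>spins. inter_w \<theta> s t * f t)"

definition absorb :: "nat \<Rightarrow> real \<Rightarrow> nat \<Rightarrow> (nat list \<Rightarrow> int \<Rightarrow> real) \<Rightarrow> nat list \<Rightarrow> int \<Rightarrow> real" where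
  "absorb k \<theta> n \<phi> v s =
     \<phi> v s * (if length v = n then \<Prod>c\<in>children k v. msg \<theta> (\<phi> c) s else 1)"

lemma finite_spins [simp]: "finite spins"
  by (simp add: spins_def)

lemma prod_level_ball:
  fixes f :: "_ \<Rightarrow> real"
  shows "(\<Prod>v\<in>ball_n k n. if length v = n then f v else 1) = (\<Prod>v\<in>level k n. f v)"
proof -
  have "level k n = {v \<in> ball_n k n. length v = n}"
    by (auto simp: ball_n_def level_def)
  then show ?thesis
    by (simp add: prod.inter_filter)
qed

text \<open>Given the spins in the ball of radius n, those on level n + 1 are independent. Their sum
  therefore factors into one message per leaf (\<open>prod_sum_PiE\<close>), which the parent
  absorbs.\<close>

lemma tree_Z_Suc: "tree_Z k \<theta> (Suc n) \<phi> = tree_Z k \<theta> n (absorb k \<theta> n \<phi>)"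
proof -
  let ?B = "ball_n k n" and ?L = "level k (Suc n)"
  have merge_tl: "merge_cfg ?B \<sigma> \<tau> (tl w) = \<sigma> (tl w)" if "w \<in> ?B \<union> ?L" for \<sigma> \<tau> w
    using that tl_in_cayley_V[of w k] by (auto simp: merge_cfg_def ball_n_def level_def)
  have merge_B: "merge_cfg ?B \<sigma> \<tau> w = \<sigma> w" if "w \<in> ?B" for \<sigma> \<tau> w
    using that by (auto simp: merge_cfg_def)
  have merge_L: "merge_cfg ?B \<sigma> \<tau> w = \<tau> w" if "w \<in> ?L" for \<sigma> \<tau> w
    using that by (auto simp: merge_cfg_def ball_n_def level_def)
  have split: "tree_weight k \<theta> (Suc n) \<phi> (merge_cfg ?B \<sigma> \<tau>) =
      tree_weight k \<theta> n \<phi> \<sigma> * (\<Prod>w\<in>?L. inter_w \<theta> (\<sigma> (tl w)) (\<tau> w) * \<phi> w (\<tau> w))" for \<sigma> \<tau>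
  proof -
    have *: "ball_n k (Suc n) - {[]} = (?B - {[]}) \<union> ?L"
      by (auto simp: ball_n_Suc level_def)
    have dj: "(?B - {[]}) \<inter> ?L = {}"
      using ball_n_level_disjoint by blast
    have "tree_weight k \<theta> (Suc n) \<phi> (merge_cfg ?B \<sigma> \<tau>) =
      ((\<Prod>w\<in>?B - {[]}. inter_w \<theta> (\<sigma> (tl w)) (\<sigma> w)) * (\<Prod>w\<in>?L. inter_w \<theta> (\<sigma> (tl w)) (\<tau> w))) *
      ((\<Prod>v\<in>?B. \<phi> v (\<sigma> v)) * (\<Prod>v\<in>?L. \<phi> v (\<tau> v)))"
      unfolding tree_weight_def * unfolding ball_n_Suc
      by (subst prod.union_disjoint, simp, simp, rule dj,
          subst prod.union_disjoint, simp, simp, rule ball_n_level_disjoint)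
        (auto simp: merge_tl merge_B merge_L intro!: arg_cong2[where f = "(*)"] prod.cong)
    then show ?thesis
      by (simp add: tree_weight_def prod.distrib)
  qed
  have "tree_Z k \<theta> (Suc n) \<phi> = (\<Sum>\<sigma>\<in>PiE ?B (\<lambda>_. spins). \<Sum>\<tau>\<in>PiE ?L (\<lambda>_. spins).
      tree_weight k \<theta> n \<phi> \<sigma> * (\<Prod>w\<in>?L. inter_w \<theta> (\<sigma> (tl w)) (\<tau> w) * \<phi> w (\<tau> w)))"
    unfolding tree_Z_def ball_n_Suc
    by (subst sum_PiE_Un[OF ball_n_level_disjoint]) (simp add: split)
  also have "\<dots> = (\<Sum>\<sigma>\<in>PiE ?B (\<lambda>_. spins). tree_weight k \<theta> n \<phi> \<sigma> *
      (\<Prod>w\<in>?L. msg \<theta> (\<phi> w) (\<sigma> (tl w))))"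
    by (simp add: sum_distrib_left[symmetric] msg_def prod_sum_PiE)
  also have "\<dots> = (\<Sum>\<sigma>\<in>PiE ?B (\<lambda>_. spins). tree_weight k \<theta> n \<phi> \<sigma> *
      (\<Prod>v\<in>?B. if length v = n then \<Prod>w\<in>children k v. msg \<theta> (\<phi> w) (\<sigma> v) else 1))"
    unfolding prod_level_ball prod_level_Suc by (simp add: children_def)
  also have "\<dots> = tree_Z k \<theta> n (absorb k \<theta> n \<phi>)"
    by (simp add: tree_Z_def tree_weight_def absorb_def prod.distrib mult.assoc)
  finally show ?thesis .
qed

section \<open>Monotonicity in the boundary messages\<close>

text \<open>The parameter \<open>e\<close> is \<open>1\<close> or \<open>-1\<close> and selects which of the two pure spin values is the
  top of the order \<open>e * s \<le> e * t\<close>. The relation \<open>mlr e a b\<close> says that \<open>b / a\<close> is nondecreasing.\<close>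

definition mlr :: "int \<Rightarrow> (int \<Rightarrow> real) \<Rightarrow> (int \<Rightarrow> real) \<Rightarrow> bool" where
  "mlr e a b \<longleftrightarrow> (\<forall>s\<in>spins. \<forall>t\<in>spins. e * s \<le> e * t \<longrightarrow> a t * b s \<le> a s * b t)"

lemma mlr_refl: "mlr e a a"
  by (simp add: mlr_def mult.commute)

text \<open>This is the stability that stochastic domination lacks: the two defining inequalities
  are simply multiplied.\<close>

lemma mlr_mult:
  assumes "mlr e a b" "mlr e c d"
    and "\<And>s. s \<in> spins \<Longrightarrow> a s \<ge> 0" "\<And>s. s \<in> spins \<Longrightarrow> b s \<ge> 0"
    and "\<And>s. s \<in> spins \<Longrightarrow> c s \<ge> 0" "\<And>s. s \<in> spins \<Longrightarrow> d s \<ge> 0"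
  shows "mlr e (\<lambda>s. a s * c s) (\<lambda>s. b s * d s)"
  unfolding mlr_def
proof (intro ballI impI)
  fix s t assume st: "s \<in> spins" "t \<in> spins" "e * s \<le> e * t"
  have "(a t * b s) * (c t * d s) \<le> (a s * b t) * (c s * d t)"
    by (rule mult_mono) (use assms st in \<open>auto simp: mlr_def\<close>)
  then show "a t * c t * (b s * d s) \<le> a s * c s * (b t * d t)"
    by (simp add: mult_ac)
qed

lemma mlr_prod:
  assumes "\<And>i. i \<in> I \<Longrightarrow> mlr e (a i) (b i)"
    and "\<And>i s. i \<in> I \<Longrightarrow> s \<in> spins \<Longrightarrow> a i s \<ge> 0" "\<And>i s. i \<in> I \<Longrightarrow> s \<in> spins \<Longrightarrow> b i s \<ge> 0"
  shows "mlr e (\<lambda>s. \<Prod>i\<in>I. a i s) (\<lambda>s. \<Prod>i\<in>I. b i s)"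
  using assms
proof (induction I rule: infinite_finite_induct)
  case (insert x F)
  then have "mlr e (\<lambda>s. a x s * (\<Prod>i\<in>F. a i s)) (\<lambda>s. b x s * (\<Prod>i\<in>F. b i s))"
    by (intro mlr_mult prod_nonneg) auto
  then show ?case
    using insert by simp
qed (simp_all add: mlr_refl)

lemma sum_spins: "(\<Sum>t\<in>spins. f t) = f (-1) + f 0 + f (1::int)" for f :: "int \<Rightarrow> real"
  by (simp add: spins_def)

text \<open>By the Binet--Cauchy identity the difference of the two sides is the sum over pairs
  \<open>s < t\<close> of products of the corresponding \<open>2 \<times> 2\<close> minors of \<open>(a, b)\<close> and \<open>(c, d)\<close>.\<close>

lemma mlr_sum_le:
  assumes "mlr e a b" "mlr e c d"
  shows "(\<Sum>t\<in>spins. a t * d t) * (\<Sum>t\<in>spins. b t * c t) \<le>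
    (\<Sum>t\<in>spins. a t * c t) * (\<Sum>t\<in>spins. b t * d t)"
proof -
  have minors: "0 \<le> (a s * b t - a t * b s) * (c s * d t - c t * d s)"
    if "s \<in> spins" "t \<in> spins" for s t
  \<comment> \<open>Exchanging s and t flips the sign of both minors, so they have equal sign in
    either order.\<close>
  proof (cases "e * s \<le> e * t")
    case True
    then show ?thesis using that assms by (intro mult_nonneg_nonneg) (auto simp: mlr_def)
  next
    case False
    then have "e * t \<le> e * s" by simp
    then show ?thesis using that assms
      by (intro mult_nonpos_nonpos) (auto simp: mlr_def)
  qed
  have "(\<Sum>t\<in>spins. a t * c t) * (\<Sum>t\<in>spins. b t * d t) -
      (\<Sum>t\<in>spins. a t * d t) * (\<Sum>t\<in>spins. b t * c t) =
      (a (-1) * b 0 - a 0 * b (-1)) * (c (-1) * d 0 - c 0 * d (-1)) +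
      (a (-1) * b 1 - a 1 * b (-1)) * (c (-1) * d 1 - c 1 * d (-1)) +
      (a 0 * b 1 - a 1 * b 0) * (c 0 * d 1 - c 1 * d 0)"
    unfolding sum_spins by (simp add: algebra_simps)
  moreover have "\<dots> \<ge> 0"
    by (intro add_nonneg_nonneg minors) (auto simp: spins_def)
  ultimately show ?thesis by linarith
qed

section \<open>Attractiveness and increasing functions\<close>

locale scwr =
  fixes k :: nat and \<theta> lam :: real and e :: int
  assumes \<theta>_pos: "0 < \<theta>" and \<theta>_less: "\<theta> < 1" and lam_pos: "0 < lam" and e_cases: "e = 1 \<or> e = -1"
begin

lemma inter_w_pos: "inter_w \<theta> s t > 0"
  using \<theta>_pos by (simp add: inter_w_def)

lemma inter_w_commute: "inter_w \<theta> s t = inter_w \<theta> t s"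
  by (simp add: inter_w_def mult.commute)

lemma act_w_pos: "act_w lam s > 0"
  using lam_pos by (simp add: act_w_def)

text \<open>Attractiveness as total positivity: with the spins in increasing order, the 2 x 2 minors
  of the interaction matrix are 0, 1 - \<theta> and 1 - \<theta>^2. Reversing rows and columns
  together keeps their signs, which covers \<open>e = -1\<close>.\<close>

lemma mlr_inter_w:
  assumes "s \<in> spins" "t \<in> spins" "e * s \<le> e * t"
  shows "mlr e (inter_w \<theta> s) (inter_w \<theta> t)"
proof -
  have "\<theta> * \<theta> \<le> 1"
    using \<theta>_pos \<theta>_less by (simp add: mult_le_one)
  then show ?thesis
    using assms e_cases \<theta>_pos \<theta>_less by (auto simp: mlr_def inter_w_def spins_def)
qed

lemma msg_pos: "(\<And>t. t \<in> spins \<Longrightarrow> f t > 0) \<Longrightarrow> msg \<theta> f s > 0"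
  unfolding msg_def by (intro sum_pos) (auto simp: inter_w_pos, auto simp: spins_def)

text \<open>A totally positive kernel preserves the likelihood ratio order: two rows of the kernel
  form one pair in \<open>mlr_sum_le\<close>, and f, g the other.\<close>

lemma mlr_msg:
  assumes "mlr e f g"
  shows "mlr e (msg \<theta> f) (msg \<theta> g)"
  unfolding mlr_def msg_def
  using mlr_sum_le[OF mlr_inter_w assms] by (auto simp: mult.commute)

text \<open>\<open>kavg f h s\<close> is the average of \<open>h\<close> under the transition law of a child with message \<open>f\<close>
  given that its parent has spin \<open>s\<close>.\<close>

definition kavg :: "(int \<Rightarrow> real) \<Rightarrow> (int \<Rightarrow> real) \<Rightarrow> int \<Rightarrow> real" where
  "kavg f h s = msg \<theta> (\<lambda>t. f t * h t) s / msg \<theta> f s"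

text \<open>Against the constant 1, \<open>mlr\<close> says that h is nondecreasing; in this form
  the closure lemmas for \<open>mlr\<close> apply directly.\<close>

definition incr :: "(int \<Rightarrow> real) \<Rightarrow> bool" where
  "incr h \<longleftrightarrow> (\<forall>s\<in>spins. h s \<ge> 0) \<and> mlr e (\<lambda>_. 1) h"

text \<open>The law of a child given its parent has weights
  \<open>inter_w \<theta> s u * f u\<close>, which grow with s in likelihood ratio by
  attractiveness, so averages of increasing functions grow too.\<close>

lemma incr_kavg:
  assumes "\<And>t. t \<in> spins \<Longrightarrow> f t > 0" "incr h"
  shows "incr (kavg f h)"
  unfolding incr_def mlr_def
proof (intro conjI ballI impI)
  fix s
  show "0 \<le> kavg f h s"
    using assms inter_w_pos unfolding kavg_def
    by (intro divide_nonneg_pos msg_pos) (auto simp: msg_def incr_def less_imp_le intro!: sum_nonneg mult_nonneg_nonneg)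
next
  fix s t assume st: "s \<in> spins" "t \<in> spins" "e * s \<le> e * t"
  have "mlr e (\<lambda>u. inter_w \<theta> s u * f u) (\<lambda>u. inter_w \<theta> t u * f u)"
    using assms(1) inter_w_pos by (intro mlr_mult mlr_inter_w st mlr_refl) (auto simp: less_imp_le)
  from mlr_sum_le[OF this, of "\<lambda>_. 1" h]
  have "msg \<theta> (\<lambda>t. f t * h t) s * msg \<theta> f t \<le> msg \<theta> f s * msg \<theta> (\<lambda>t. f t * h t) t"
    using assms(2) by (simp add: msg_def incr_def mult.assoc)
  then show "1 * kavg f h s \<le> 1 * kavg f h t"
    using msg_pos[of f s] msg_pos[of f t] assms(1) by (simp add: kavg_def field_simps)
qed

text \<open>Two moves: passing from f to g raises the average because h is increasing, and passing
  from h to h' raises it pointwise.\<close>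

lemma kavg_mono:
  assumes "\<And>t. t \<in> spins \<Longrightarrow> f t > 0" "\<And>t. t \<in> spins \<Longrightarrow> g t > 0" "mlr e f g" "incr h"
    and "\<And>t. t \<in> spins \<Longrightarrow> h t \<le> h' t"
  shows "kavg f h s \<le> kavg g h' s"
proof -
  have "mlr e (\<lambda>u. inter_w \<theta> s u * f u) (\<lambda>u. inter_w \<theta> s u * g u)"
    using assms inter_w_pos by (intro mlr_mult mlr_refl) (auto simp: less_imp_le)
  from mlr_sum_le[OF this, of "\<lambda>_. 1" h]
  have "msg \<theta> (\<lambda>t. f t * h t) s * msg \<theta> g s \<le> msg \<theta> f s * msg \<theta> (\<lambda>t. g t * h t) s"
    using assms(4) by (simp add: msg_def incr_def mult.assoc)
  also have "\<dots> \<le> msg \<theta> f s * msg \<theta> (\<lambda>t. g t * h' t) s"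
    using msg_pos[of f s] assms(1,2,5) inter_w_pos
    by (intro mult_left_mono) (auto simp: msg_def less_imp_le intro!: sum_mono mult_left_mono)
  finally show ?thesis
    using msg_pos[of f s] msg_pos[of g s] assms(1,2) by (simp add: kavg_def field_simps)
qed

lemma incr_mult_prod:
  assumes "incr h" "\<And>i. i \<in> I \<Longrightarrow> incr (g i)"
  shows "incr (\<lambda>s. h s * (\<Prod>i\<in>I. g i s))"
proof -
  have "mlr e (\<lambda>s. 1 * (\<Prod>i\<in>I. 1)) (\<lambda>s. h s * (\<Prod>i\<in>I. g i s))"
    using assms by (intro mlr_mult mlr_prod prod_nonneg) (auto simp: incr_def)
  then show ?thesis
    using assms by (auto simp: incr_def intro!: mult_nonneg_nonneg prod_nonneg)
qed

section \<open>Comparison of tree partition functions\<close>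

lemma tree_Z_pos:
  assumes "\<And>v s. v \<in> ball_n k n \<Longrightarrow> s \<in> spins \<Longrightarrow> \<phi> v s > 0"
  shows "tree_Z k \<theta> n \<phi> > 0"
  unfolding tree_Z_def
proof (rule sum_pos)
  show "PiE (ball_n k n) (\<lambda>_. spins) \<noteq> {}"
    by (simp add: PiE_eq_empty_iff) (simp add: spins_def)
qed (auto simp: tree_weight_def inter_w_pos intro!: finite_PiE mult_pos_pos prod_pos assms)

lemma tree_Z_0: "tree_Z k \<theta> 0 \<phi> = (\<Sum>s\<in>spins. \<phi> [] s)"
proof -
  have "tree_Z k \<theta> 0 \<phi> = (\<Sum>\<sigma>\<in>PiE {[]} (\<lambda>_. spins). \<Prod>v\<in>{[]}. \<phi> v (\<sigma> v))"
    by (simp add: tree_Z_def tree_weight_def ball_n_0)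
  also have "\<dots> = (\<Sum>s\<in>spins. \<phi> [] s)"
    by (subst prod_sum_PiE[symmetric]) auto
  finally show ?thesis .
qed

text \<open>Each quotient is the mean of a product of increasing site functions under a tree
  measure. Leaves are removed level by level, their site functions being replaced by conditional
  means given the parent. Two families h and h' are carried along because these means differ under
  \<psi> and \<psi>' even if h = h' at the start.\<close>

lemma tree_Z_ratio_mono:
  assumes "\<And>v s. v \<in> ball_n k n \<Longrightarrow> s \<in> spins \<Longrightarrow> \<psi> v s > 0"
    and "\<And>v s. v \<in> ball_n k n \<Longrightarrow> s \<in> spins \<Longrightarrow> \<psi>' v s > 0"
    and "\<And>v. v \<in> ball_n k n \<Longrightarrow> mlr e (\<psi> v) (\<psi>' v)"
    and "\<And>v. v \<in> ball_n k n \<Longrightarrow> incr (h v)" "\<And>v. v \<in> ball_n k n \<Longrightarrow> incr (h' v)"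
    and "\<And>v s. v \<in> ball_n k n \<Longrightarrow> s \<in> spins \<Longrightarrow> h v s \<le> h' v s"
  shows "tree_Z k \<theta> n (\<lambda>v s. \<psi> v s * h v s) / tree_Z k \<theta> n \<psi> \<le>
    tree_Z k \<theta> n (\<lambda>v s. \<psi>' v s * h' v s) / tree_Z k \<theta> n \<psi>'"
  using assms
proof (induction n arbitrary: \<psi> \<psi>' h h')
  case 0
  have "(\<Sum>s\<in>spins. \<psi> [] s * h [] s) * (\<Sum>s\<in>spins. \<psi>' [] s) \<le>
      (\<Sum>s\<in>spins. \<psi> [] s) * (\<Sum>s\<in>spins. \<psi>' [] s * h [] s)"
    using mlr_sum_le[of e "\<psi> []" "\<psi>' []" "\<lambda>_. 1" "h []"] 0 by (simp add: incr_def)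
  also have "\<dots> \<le> (\<Sum>s\<in>spins. \<psi> [] s) * (\<Sum>s\<in>spins. \<psi>' [] s * h' [] s)"
    using 0 by (intro mult_left_mono sum_mono sum_nonneg) (auto simp: less_imp_le)
  finally show ?case
    using tree_Z_pos[of 0 \<psi>] tree_Z_pos[of 0 \<psi>'] 0 by (simp add: tree_Z_0 field_simps)
next
  case (Suc n)
  \<comment> \<open>The site functions after one removal: a vertex on level n collects the
    conditional means of its children; elsewhere the index set is empty.\<close>
  define H where "H f g v s = g v s *
    (\<Prod>c\<in>(if length v = n then children k v else {}). kavg (f c) (g c) s)" for f g v s
  have child: "c \<in> ball_n k (Suc n)" if "c \<in> children k v" "length v = n" for c v
    using that by (auto simp: children_def ball_n_def)
  have inner: "v \<in> ball_n k (Suc n)" if "v \<in> ball_n k n" for v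
    using that by (auto simp: ball_n_def)
  have absorb_mult: "tree_Z k \<theta> (Suc n) (\<lambda>v s. f v s * g v s) =
      tree_Z k \<theta> n (\<lambda>v s. absorb k \<theta> n f v s * H f g v s)"
    if "\<And>v s. v \<in> ball_n k (Suc n) \<Longrightarrow> s \<in> spins \<Longrightarrow> f v s > 0" for f g
  proof -
    have "absorb k \<theta> n (\<lambda>v s. f v s * g v s) = (\<lambda>v s. absorb k \<theta> n f v s * H f g v s)"
    proof (intro ext)
      fix v s
      show "absorb k \<theta> n (\<lambda>v s. f v s * g v s) v s = absorb k \<theta> n f v s * H f g v s"
      proof (cases "length v = n")
        case True
        \<comment> \<open>The tilted message splits into the plain message, kept in
          \<open>absorb\<close>, and a conditional mean, kept in H.\<close>
        have "msg \<theta> (f c) s * kavg (f c) (g c) s = msg \<theta> (\<lambda>s. f c s * g c s) s"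
          if "c \<in> children k v" for c
          using msg_pos[of "f c" s] that child True \<open>\<And>v s. v \<in> ball_n k (Suc n) \<Longrightarrow> s \<in> spins \<Longrightarrow> f v s > 0\<close>
          by (force simp: kavg_def)
        then show ?thesis
          using True by (simp add: absorb_def H_def mult_ac flip: prod.distrib)
      qed (simp add: absorb_def H_def)
    qed
    then show ?thesis
      by (simp add: tree_Z_Suc)
  qed
  have absorb_pos: "absorb k \<theta> n f v s > 0"
    if "\<And>v s. v \<in> ball_n k (Suc n) \<Longrightarrow> s \<in> spins \<Longrightarrow> f v s > 0" "v \<in> ball_n k n" "s \<in> spins" for f v s
    using that child inner by (auto simp: absorb_def intro!: mult_pos_pos prod_pos msg_pos)
  have "tree_Z k \<theta> n (\<lambda>v s. absorb k \<theta> n \<psi> v s * H \<psi> h v s) / tree_Z k \<theta> n (absorb k \<theta> n \<psi>) \<le>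
    tree_Z k \<theta> n (\<lambda>v s. absorb k \<theta> n \<psi>' v s * H \<psi>' h' v s) / tree_Z k \<theta> n (absorb k \<theta> n \<psi>')"
  proof (rule Suc.IH)
    fix v assume v: "v \<in> ball_n k n"
    show "mlr e (absorb k \<theta> n \<psi> v) (absorb k \<theta> n \<psi>' v)"
    proof (cases "length v = n")
      case True
      have "mlr e (\<lambda>s. \<psi> v s * (\<Prod>c\<in>children k v. msg \<theta> (\<psi> c) s))
          (\<lambda>s. \<psi>' v s * (\<Prod>c\<in>children k v. msg \<theta> (\<psi>' c) s))"
        using Suc.prems(1-3) child[OF _ True] inner[OF v] True
        by (intro mlr_mult mlr_prod mlr_msg prod_nonneg) (auto intro!: less_imp_le msg_pos)
      then show ?thesis using True by (simp add: absorb_def[abs_def])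
    qed (use Suc.prems inner v in \<open>simp add: absorb_def[abs_def]\<close>)
    show "incr (H \<psi> h v)"
      unfolding H_def using Suc.prems child inner[OF v]
      by (intro incr_mult_prod incr_kavg) (auto split: if_splits)
    show "incr (H \<psi>' h' v)"
      unfolding H_def using Suc.prems child inner[OF v]
      by (intro incr_mult_prod incr_kavg) (auto split: if_splits)
    fix s assume s: "s \<in> spins"
    show "H \<psi> h v s \<le> H \<psi>' h' v s"
      unfolding H_def
    proof (intro mult_mono prod_mono conjI)
      fix c assume "c \<in> (if length v = n then children k v else {})"
      then have c: "c \<in> ball_n k (Suc n)" using child by (auto split: if_splits)
      show "kavg (\<psi> c) (h c) s \<le> kavg (\<psi>' c) (h' c) s"
        using Suc.prems c by (intro kavg_mono) auto
      have "incr (kavg (\<psi> c) (h c))"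
        using Suc.prems c by (intro incr_kavg) auto
      then show "0 \<le> kavg (\<psi> c) (h c) s"
        using s by (simp add: incr_def)
    next
      have "incr (\<lambda>s. 1 * (\<Prod>c\<in>(if length v = n then children k v else {}). kavg (\<psi> c) (h c) s))"
        using Suc.prems child inner[OF v]
        by (intro incr_mult_prod incr_kavg) (auto split: if_splits simp: incr_def mlr_refl)
      then show "0 \<le> (\<Prod>c\<in>(if length v = n then children k v else {}). kavg (\<psi> c) (h c) s)"
        using s by (simp add: incr_def)
    qed (use Suc.prems inner[OF v] s in \<open>auto simp: incr_def\<close>)
  qed (use absorb_pos Suc.prems in auto)
  moreover have "tree_Z k \<theta> (Suc n) (\<lambda>v s. \<psi> v s * h v s) =
      tree_Z k \<theta> n (\<lambda>v s. absorb k \<theta> n \<psi> v s * H \<psi> h v s)"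
    by (rule absorb_mult) (rule Suc.prems(1))
  moreover have "tree_Z k \<theta> (Suc n) (\<lambda>v s. \<psi>' v s * h' v s) =
      tree_Z k \<theta> n (\<lambda>v s. absorb k \<theta> n \<psi>' v s * H \<psi>' h' v s)"
    by (rule absorb_mult) (rule Suc.prems(2))
  ultimately show ?case
    by (simp only: tree_Z_Suc[of _ _ _ \<psi>] tree_Z_Suc[of _ _ _ \<psi>'])
qed

end

section \<open>The boundary law equation\<close>

text \<open>Writing \<open>x = lam u^k\<close> and \<open>y = lam v^k\<close>, the system becomes
  \<open>S (1 - u) = (1 - \<theta>) lam v^k\<close>, \<open>S (1 - v) = (1 - \<theta>) lam u^k\<close> with \<open>S = 1 + x + y\<close>. Eliminating
  \<open>S\<close> in two ways and dividing by \<open>u - v\<close> leaves two equations for \<open>s = u + v\<close> and \<open>p = u v\<close>,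
  of which the second determines \<open>s\<close>.\<close>

lemma reduced_system:
  fixes u v \<theta> lam :: real
  assumes "u = (1 + lam * u ^ k + \<theta> * (lam * v ^ k)) / (1 + lam * u ^ k + lam * v ^ k)"
    and "v = (1 + \<theta> * (lam * u ^ k) + lam * v ^ k) / (1 + lam * u ^ k + lam * v ^ k)"
    and "0 < u" "0 < v" "0 < lam" "\<theta> < 1"
  shows "u ^ k * (1 - u) = v ^ k * (1 - v)"
    and "(1 + lam * u ^ k + lam * v ^ k) * (u - v) = (1 - \<theta>) * lam * (u ^ k - v ^ k)"
proof -
  define S where "S = 1 + lam * u ^ k + lam * v ^ k"
  have S: "S > 0" unfolding S_def using assms by (intro add_pos_pos mult_pos_pos) auto
  have "u * S = 1 + lam * u ^ k + \<theta> * (lam * v ^ k)"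
    using assms(1) S unfolding S_def by (simp add: field_simps)
  then have 1: "(1 - u) * S = (1 - \<theta>) * lam * v ^ k"
    by (simp add: S_def algebra_simps)
  have "v * S = 1 + \<theta> * (lam * u ^ k) + lam * v ^ k"
    using assms(2) S unfolding S_def by (simp add: field_simps)
  then have 2: "(1 - v) * S = (1 - \<theta>) * lam * u ^ k"
    by (simp add: S_def algebra_simps)
  \<comment> \<open>Multiplied by S, both sides of the goal become (1 - \<theta>) lam u^k
    v^k.\<close>
  have "S * (u ^ k * (1 - u)) = u ^ k * ((1 - u) * S)" by simp
  also have "\<dots> = v ^ k * ((1 - v) * S)" unfolding 1 2 by simp
  finally have "S * (u ^ k * (1 - u)) = S * (v ^ k * (1 - v))" by (simp add: mult_ac)
  then show "u ^ k * (1 - u) = v ^ k * (1 - v)"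
    using S by simp
  show "(1 + lam * u ^ k + lam * v ^ k) * (u - v) = (1 - \<theta>) * lam * (u ^ k - v ^ k)"
    using 1 2 unfolding S_def[symmetric] by (simp add: algebra_simps)
qed

text \<open>By Vieta, u is a root of the quadratic with roots u' and v'; the ordering decides which
  one.\<close>

lemma eq_of_sum_prod_eq:
  fixes u v u' v' :: real
  assumes "u + v = u' + v'" "u * v = u' * v'" "v < u" "v' < u'"
  shows "u = u' \<and> v = v'"
proof -
  have "(u - u') * (u - v') = u * u - u * (u' + v') + u' * v'" by (simp add: algebra_simps)
  also have "\<dots> = 0" unfolding assms(1,2)[symmetric] by (simp add: algebra_simps)
  finally have "u = u' \<or> u = v'" by simp
  then show ?thesis using assms by auto
qed

text \<open>Cancelling u - v in the first equation gives s = s^2 - p. Inserting u^2 + v^2 = s^2 - 2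
  p = 2 s - s^2 in the second leaves an equation in s alone.\<close>

lemma quadratic_system_sum_prod:
  fixes u v :: real
  assumes "u ^ 2 * (1 - u) = v ^ 2 * (1 - v)"
    and "(1 + lam * u ^ 2 + lam * v ^ 2) * (u - v) = (1 - \<theta>) * lam * (u ^ 2 - v ^ 2)"
    and "u \<noteq> v"
  shows "u * v = (u + v)\<^sup>2 - (u + v)" "lam * ((u + v) * (u + v - (1 + \<theta>))) = 1"
proof -
  have "(u - v) * (u + v - ((u + v)\<^sup>2 - u * v)) = 0"
    using assms(1) by (simp add: algebra_simps power2_eq_square power3_eq_cube)
  then show p: "u * v = (u + v)\<^sup>2 - (u + v)" using assms(3) by simp
  have "(u - v) * (1 + lam * u ^ 2 + lam * v ^ 2 - (1 - \<theta>) * lam * (u + v)) = 0"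
    using assms(2) by algebra
  then have "1 + lam * (u ^ 2 + v ^ 2) - (1 - \<theta>) * lam * (u + v) = 0"
    using assms(3) by (simp add: distrib_left)
  moreover have "u ^ 2 + v ^ 2 = 2 * (u + v) - (u + v)\<^sup>2"
    using p by algebra
  ultimately have "1 + lam * (2 * (u + v) - (u + v)\<^sup>2) - (1 - \<theta>) * lam * (u + v) = 0"
    by metis
  then show "lam * ((u + v) * (u + v - (1 + \<theta>))) = 1"
    by (simp add: algebra_simps power2_eq_square)
qed

text \<open>The first equation now reads p (2 s - 1) = s^2 (s - 1), so solving for p needs the sign
  of 2 s - 1; the bound s > 1 supplies it.\<close>

lemma cubic_system_sum_prod:
  fixes u v :: real
  assumes "u ^ 3 * (1 - u) = v ^ 3 * (1 - v)"
    and "(1 + lam * u ^ 3 + lam * v ^ 3) * (u - v) = (1 - \<theta>) * lam * (u ^ 3 - v ^ 3)"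
    and "u \<noteq> v" "0 < u" "0 < v"
  shows "u + v > 1" "u * v = (u + v)\<^sup>2 * (u + v - 1) / (2 * (u + v) - 1)"
    "lam * ((u + v) ^ 3 / (2 * (u + v) - 1) * (u + v - (1 + \<theta>))) = 1"
proof -
  define s p where "s = u + v" and "p = u * v"
  have "(u - v) * (s\<^sup>2 - p - s * (s\<^sup>2 - 2 * p)) = 0"
    using assms(1) unfolding s_def p_def by algebra
  then have "s\<^sup>2 - p - s * (s\<^sup>2 - 2 * p) = 0" using assms(3) by simp
  then have p: "p * (2 * s - 1) = s\<^sup>2 * (s - 1)"
    by (simp add: algebra_simps power2_eq_square)
  have pos: "s > 0" "p > 0" using assms unfolding s_def p_def by auto
  have "s\<^sup>2 - 4 * p = (u - v)\<^sup>2" unfolding s_def p_def by (simp add: algebra_simps power2_eq_square)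
  then have le: "4 * p \<le> s\<^sup>2" by (metis diff_ge_0_iff_ge zero_le_power2)
  \<comment> \<open>If s \<le> 1, then p > 0 forces s \<le> 1/2, and 4 p \<le> s^2 turns into s^2 (3
    - 2 s) \<le> 0, which is absurd.\<close>
  have s1: "s > 1"
  proof (rule ccontr)
    assume "\<not> s > 1"
    then have "p * (2 * s - 1) \<le> 0"
      unfolding p by (intro mult_nonneg_nonpos) auto
    then have half: "1 - 2 * s \<ge> 0" using pos by (simp add: mult_le_0_iff)
    have "4 * p * (1 - 2 * s) \<le> s\<^sup>2 * (1 - 2 * s)"
      using le half by (intro mult_right_mono)
    moreover have "4 * p * (1 - 2 * s) = s\<^sup>2 * (4 - 4 * s)"
      using p by (simp add: algebra_simps)
    ultimately have "s\<^sup>2 * (3 - 2 * s) \<le> 0" by (simp add: algebra_simps)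
    then show False using pos half by (simp add: mult_le_0_iff)
  qed
  then show "u + v > 1" by (simp add: s_def)
  have "p = s\<^sup>2 * (s - 1) / (2 * s - 1)" using p s1 by (simp add: field_simps)
  then show "u * v = (u + v)\<^sup>2 * (u + v - 1) / (2 * (u + v) - 1)" by (simp add: s_def p_def)
  have "(u - v) * (1 + lam * (s ^ 3 - 3 * s * p) - (1 - \<theta>) * lam * (s\<^sup>2 - p)) = 0"
    using assms(2) unfolding s_def p_def by algebra
  then have "1 + lam * (s ^ 3 - 3 * s * p) - (1 - \<theta>) * lam * (s\<^sup>2 - p) = 0"
    using assms(3) by simp
  \<comment> \<open>Multiplying by 2 s - 1 eliminates p without division.\<close>
  then have "(2 * s - 1) + lam * (s ^ 3 * (s - 1 - \<theta>) * (-1)) = 0"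
    using p by algebra
  then have "lam * (s ^ 3 * (s - (1 + \<theta>))) = 2 * s - 1" by (simp add: algebra_simps)
  then have "lam * (s ^ 3 * (s - (1 + \<theta>))) / (2 * s - 1) = 1"
    using s1 by simp
  then show "lam * ((u + v) ^ 3 / (2 * (u + v) - 1) * (u + v - (1 + \<theta>))) = 1"
    unfolding s_def by (simp only: times_divide_eq_right times_divide_eq_left)
qed

section \<open>Uniqueness of the sum s\<close>

lemma quadratic_strict:
  fixes s t a :: real
  assumes "0 < s" "s < t" "s > a"
  shows "s * (s - a) < t * (t - a)"
  using assms by (intro mult_strict_mono) auto

text \<open>The value 1 / lam is positive, which places s and t to the right of a, where the
  function is strictly increasing.\<close>

lemma quadratic_sum_unique:
  assumes "lam > 0" "lam * (s * (s - a)) = 1" "lam * (t * (t - a)) = 1" "0 < s" "0 < t"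
  shows "s = (t :: real)"
proof -
  have "s * (s - a) > 0" "t * (t - a) > 0" 
    using assms by (smt (verit) zero_less_mult_iff)+
  then have "s > a" "t > a" using assms by (auto simp: zero_less_mult_iff)
  moreover have "s * (s - a) = t * (t - a)" using assms by (metis less_irrefl mult_cancel_left)
  ultimately show ?thesis
    using quadratic_strict[of s t a] quadratic_strict[of t s a] assms by linarith
qed

text \<open>After cross-multiplication the difference has the factor t - s; for s, t > 1 each
  quadratic term of the cofactor is dominated by a cubic one.\<close>

lemma cube_div_mono:
  fixes s t :: real
  assumes "1 < s" "s < t"
  shows "s ^ 3 / (2 * s - 1) \<le> t ^ 3 / (2 * t - 1)"
proof -
  have "t ^ 3 * (2 * s - 1) - s ^ 3 * (2 * t - 1) =
      (t - s) * (2 * s * t * (t + s) - (t * t + t * s + s * s))"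
    by (simp add: algebra_simps power3_eq_cube)
  moreover have "t * t \<le> s * (t * t)" "s * s \<le> t * (s * s)" "t * s \<le> s * (t * s)" "0 < s * (t * t)"
    using assms mult_right_mono[of 1 s "t * t"] mult_right_mono[of 1 t "s * s"]
      mult_right_mono[of 1 s "t * s"] by auto
  moreover have "2 * s * t * (t + s) = 2 * (s * (t * t)) + t * (s * s) + s * (t * s)"
    by (simp add: algebra_simps)
  ultimately have "t ^ 3 * (2 * s - 1) - s ^ 3 * (2 * t - 1) =
      (t - s) * (2 * s * t * (t + s) - (t * t + t * s + s * s))"
    "2 * s * t * (t + s) - (t * t + t * s + s * s) \<ge> 0"
    by linarith+
  then have "s ^ 3 * (2 * t - 1) \<le> t ^ 3 * (2 * s - 1)"
    using assms by (smt (verit) mult_nonneg_nonneg)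
  then show ?thesis using assms by (simp add: field_simps)
qed

lemma cubic_strict:
  fixes s t a :: real
  assumes "1 < s" "s < t" "s > a"
  shows "s ^ 3 / (2 * s - 1) * (s - a) < t ^ 3 / (2 * t - 1) * (t - a)"
proof (rule mult_le_less_imp_less)
  show "s ^ 3 / (2 * s - 1) \<le> t ^ 3 / (2 * t - 1)" using assms by (intro cube_div_mono)
qed (use assms in auto)

lemma cubic_sum_unique:
  assumes "lam > 0" "lam * (s ^ 3 / (2 * s - 1) * (s - a)) = 1"
    "lam * (t ^ 3 / (2 * t - 1) * (t - a)) = 1" "1 < s" "1 < t"
  shows "s = (t :: real)"
proof -
  have "s ^ 3 / (2 * s - 1) > 0" "t ^ 3 / (2 * t - 1) > 0" using assms(4,5) by auto
  moreover have "s ^ 3 / (2 * s - 1) * (s - a) > 0" "t ^ 3 / (2 * t - 1) * (t - a) > 0"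
    using assms(1-3) by (metis zero_less_mult_pos zero_less_one)+
  ultimately have "s > a" "t > a" using assms by (auto simp only: zero_less_mult_iff)
  moreover have "s ^ 3 / (2 * s - 1) * (s - a) = t ^ 3 / (2 * t - 1) * (t - a)"
    using assms by (metis less_irrefl mult_cancel_left)
  ultimately show ?thesis
    using cubic_strict[of s t a] cubic_strict[of t s a] assms by linarith
qed

text \<open>Boundary laws are normalised to 1 at spin 0; the common denominator is the message
  received at spin 0.\<close>

definition bl_step :: "nat \<Rightarrow> real \<Rightarrow> real \<Rightarrow> real \<times> real \<Rightarrow> real \<times> real" where
  "bl_step k \<theta> lam p = (lam * ((1 + fst p + \<theta> * snd p) / (1 + fst p + snd p)) ^ k,
     lam * ((1 + \<theta> * fst p + snd p) / (1 + fst p + snd p)) ^ k)"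

lemma asymmetric_fixed_point_unique:
  assumes "k \<in> {2, 3}" "0 < \<theta>" "\<theta> < 1" "0 < lam"
    and "bl_step k \<theta> lam (x, y) = (x, y)" "0 < y" "y < x"
    and "bl_step k \<theta> lam (x', y') = (x', y')" "0 < y'" "y' < x'"
  shows "x = x' \<and> y = y'"
proof -
  \<comment> \<open>At a fixed point U and V are the k-th roots of x / lam and y / lam, and U - V =
    (1 - \<theta>) (x - y) / (1 + x + y) transfers the order y < x to them.\<close>
  define U where "U x y = (1 + x + \<theta> * y) / (1 + x + y)" for x y
  define V where "V x y = (1 + \<theta> * x + y) / (1 + x + y)" for x y
  have *: "x = lam * (U x y) ^ k \<and> y = lam * (V x y) ^ k \<and> 0 < V x y \<and> V x y < U x y \<and>
      U x y ^ k * (1 - U x y) = V x y ^ k * (1 - V x y) \<and>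
      (1 + lam * U x y ^ k + lam * V x y ^ k) * (U x y - V x y) = (1 - \<theta>) * lam * (U x y ^ k - V x y ^ k)"
    if fp: "bl_step k \<theta> lam (x, y) = (x, y)" and "0 < y" "y < x" for x y
  proof -
    have x: "lam * (U x y) ^ k = x" and y: "lam * (V x y) ^ k = y"
      using fp by (auto simp: bl_step_def U_def V_def)
    have "0 < (1 - \<theta>) * (x - y)" using assms that by auto
    then have lt: "V x y < U x y"
      unfolding U_def V_def using that by (intro divide_strict_right_mono) (auto simp: algebra_simps)
    have V: "0 < V x y" 
      unfolding V_def using that assms by (intro divide_pos_pos add_pos_pos mult_pos_pos) auto
    have "U x y = (1 + lam * U x y ^ k + \<theta> * (lam * V x y ^ k)) / (1 + lam * U x y ^ k + lam * V x y ^ k)"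
      "V x y = (1 + \<theta> * (lam * U x y ^ k) + lam * V x y ^ k) / (1 + lam * U x y ^ k + lam * V x y ^ k)"
      unfolding x y by (simp_all add: U_def V_def)
    from reduced_system[OF this] lt V assms x y show ?thesis by auto
  qed
  note 1 = *[OF assms(5-7)] and 2 = *[OF assms(8-10)]
  define u v u' v' where "u = U x y" and "v = V x y" and "u' = U x' y'" and "v' = V x' y'"
  note 1 = 1[folded u_def v_def] and 2 = 2[folded u'_def v'_def]
  have "u + v = u' + v' \<and> u * v = u' * v'"
  proof (cases "k = 2")
    case True
    have q1: "u * v = (u + v)\<^sup>2 - (u + v)" "lam * ((u + v) * (u + v - (1 + \<theta>))) = 1"
      using 1 unfolding True by (auto intro: quadratic_system_sum_prod)
    have q2: "u' * v' = (u' + v')\<^sup>2 - (u' + v')" "lam * ((u' + v') * (u' + v' - (1 + \<theta>))) = 1"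
      using 2 unfolding True by (auto intro: quadratic_system_sum_prod)
    have "u + v = u' + v'"
      using quadratic_sum_unique[OF assms(4) q1(2) q2(2)] 1 2 by auto
    then show ?thesis using q1(1) q2(1) by simp
  next
    case False
    then have k3: "k = 3" using assms(1) by auto
    have "v < u" "0 < v" "v' < u'" "0 < v'" using 1 2 by auto
    then have u: "u \<noteq> v" "0 < u" "0 < v" "u' \<noteq> v'" "0 < u'" "0 < v'" by auto
    note c1 = cubic_system_sum_prod[of u v lam \<theta>, OF _ _ u(1-3)]
    note c2 = cubic_system_sum_prod[of u' v' lam \<theta>, OF _ _ u(4-6)]
    have e: "u ^ 3 * (1 - u) = v ^ 3 * (1 - v)"
      "(1 + lam * u ^ 3 + lam * v ^ 3) * (u - v) = (1 - \<theta>) * lam * (u ^ 3 - v ^ 3)"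
      "u' ^ 3 * (1 - u') = v' ^ 3 * (1 - v')"
      "(1 + lam * u' ^ 3 + lam * v' ^ 3) * (u' - v') = (1 - \<theta>) * lam * (u' ^ 3 - v' ^ 3)"
      using 1 2 unfolding k3 by auto
    have "u + v = u' + v'"
      using cubic_sum_unique[OF assms(4) c1(3)[OF e(1,2)] c2(3)[OF e(3,4)]]
        c1(1)[OF e(1,2)] c2(1)[OF e(3,4)] by auto
    then show ?thesis using c1(2)[OF e(1,2)] c2(2)[OF e(3,4)] by simp
  qed
  then have "u = u' \<and> v = v'"
    using 1 2 by (intro eq_of_sum_prod_eq) auto
  then show ?thesis using 1 2 by metis
qed

text \<open>For p = (a, b) the fractions are 1 - (1 - \<theta>) b / (1 + a + b) and 1 - (1 -
  \<theta>) a / (1 + a + b). Raising a and lowering b raises the first and lowers the second, so the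
  map is monotone in this mixed order.\<close>

lemma bl_step_mono:
  assumes "0 < \<theta>" "\<theta> < 1" "0 < lam" "fst p \<le> fst q" "snd q \<le> snd p" "0 < fst p" "0 < snd q"
  shows "fst (bl_step k \<theta> lam p) \<le> fst (bl_step k \<theta> lam q)"
    "snd (bl_step k \<theta> lam q) \<le> snd (bl_step k \<theta> lam p)"
proof -
  obtain a b c d where pq: "p = (a, b)" "q = (c, d)" by (metis surj_pair)
  have pos: "0 < a" "0 < b" "0 < c" "0 < d" "a \<le> c" "d \<le> b" using assms pq by auto
  have "a * d \<le> c * b" using pos by (intro mult_mono) auto
  then have *: "d * (1 + a) \<le> b * (1 + c)" using pos by (simp add: algebra_simps)
  then have "0 \<le> (1 - \<theta>) * (b * (1 + c) - d * (1 + a))" using assms by simp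
  then have 1: "(1 + a + \<theta> * b) / (1 + a + b) \<le> (1 + c + \<theta> * d) / (1 + c + d)"
    using pos by (simp add: divide_simps) (simp add: algebra_simps)
  have "a * (1 + d) \<le> c * (1 + b)" using \<open>a * d \<le> c * b\<close> pos by (simp add: algebra_simps)
  then have "0 \<le> (1 - \<theta>) * (c * (1 + b) - a * (1 + d))" using assms by simp
  then have 2: "(1 + \<theta> * c + d) / (1 + c + d) \<le> (1 + \<theta> * a + b) / (1 + a + b)"
    using pos by (simp add: divide_simps) (simp add: algebra_simps)
  show "fst (bl_step k \<theta> lam p) \<le> fst (bl_step k \<theta> lam q)"
    "snd (bl_step k \<theta> lam q) \<le> snd (bl_step k \<theta> lam p)"
    using 1 2 pos assms
    by (auto simp: bl_step_def pq intro!: mult_left_mono power_mono divide_nonneg_pos add_nonneg_nonneg)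
qed

text \<open>Both fractions lie between \<theta> and 1. The pair
  \<open>(lam, lam * \<theta> ^ k)\<close> is the extreme case, so it lies above every image in the
  mixed order and can start a monotone iteration.\<close>

lemma bl_step_bounds:
  assumes "0 < \<theta>" "\<theta> < 1" "0 < lam" "0 < fst p" "0 < snd p"
  shows "0 < fst (bl_step k \<theta> lam p)" "fst (bl_step k \<theta> lam p) \<le> lam"
    "lam * \<theta> ^ k \<le> snd (bl_step k \<theta> lam p)"
proof -
  obtain a b where p: "p = (a, b)" by (metis surj_pair)
  have pos: "0 < a" "0 < b" using assms p by auto
  have "\<theta> * b \<le> b" using assms pos by simp
  then have 1: "(1 + a + \<theta> * b) / (1 + a + b) \<le> 1" using pos by simp
  have 0: "(1 + a + \<theta> * b) / (1 + a + b) > 0"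
    using pos assms by (intro divide_pos_pos add_pos_pos mult_pos_pos) auto
  have "\<theta> * b \<le> b" "\<theta> \<le> 1" using assms pos by auto
  then have "\<theta> * (1 + a + b) \<le> 1 + \<theta> * a + b" unfolding distrib_left by linarith
  then have 2: "\<theta> \<le> (1 + \<theta> * a + b) / (1 + a + b)" using pos by (simp add: pos_le_divide_eq)
  show "0 < fst (bl_step k \<theta> lam p)" "fst (bl_step k \<theta> lam p) \<le> lam"
    using 0 1 assms by (simp_all add: bl_step_def p power_le_one)
  show "lam * \<theta> ^ k \<le> snd (bl_step k \<theta> lam p)"
    using 2 assms by (simp add: bl_step_def p power_mono)
qed

text \<open>Iterating from the message of an all-plus boundary gives the extremal fixed point.\<close>

lemma bl_step_iterates_tendsto:
  assumes k: "k \<in> {2, 3}" and th: "0 < \<theta>" "\<theta> < 1" "0 < lam"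
    and fp: "bl_step k \<theta> lam (x, y) = (x, y)" and xy: "0 < y" "y < x"
  defines "P \<equiv> \<lambda>j. (bl_step k \<theta> lam ^^ j) (lam, lam * \<theta> ^ k)"
  shows "(\<lambda>j. fst (P j)) \<longlonglongrightarrow> x" "(\<lambda>j. snd (P j)) \<longlonglongrightarrow> y"
proof -
  have P_Suc: "P (Suc j) = bl_step k \<theta> lam (P j)" for j by (simp add: P_def)
  have lower: "x \<le> fst (P j) \<and> snd (P j) \<le> y \<and> 0 < snd (P j)" for j
  proof (induction j)
    case 0
    show ?case using bl_step_bounds[OF th, of "(x, y)" k] xy fp th by (simp add: P_def)
  next
    case (Suc j)
    have "0 < snd (P (Suc j))"
      using bl_step_bounds(3)[OF th, of "P j" k] Suc xy th unfolding P_Suc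
      by (smt (verit) mult_pos_pos zero_less_power)
    then show ?case
      using bl_step_mono[OF th, of "(x, y)" "P j" k] Suc xy fp by (simp add: P_Suc)
  qed
  have step: "fst (P (Suc j)) \<le> fst (P j) \<and> snd (P j) \<le> snd (P (Suc j))" for j
  proof (induction j)
    case 0
    have "P 0 = (lam, lam * \<theta> ^ k)" by (simp add: P_def)
    then show ?case
      using bl_step_bounds[OF th, of "P 0" k] th lower[of 0] by (simp add: P_Suc)
  next
    case (Suc j)
    show ?case
      using bl_step_mono[OF th, of "P (Suc j)" "P j" k] Suc lower[of "Suc j"] lower[of j] xy
      unfolding P_Suc by auto
  qed
  have dec: "decseq (\<lambda>j. fst (P j))" and inc: "incseq (\<lambda>j. snd (P j))"
    using step by (auto simp: decseq_Suc_iff incseq_Suc_iff)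
  obtain X where X: "(\<lambda>j. fst (P j)) \<longlonglongrightarrow> X" "\<And>j. X \<le> fst (P j)"
    using decseq_convergent[OF dec, of x] lower by auto
  obtain Y where Y: "(\<lambda>j. snd (P j)) \<longlonglongrightarrow> Y" "\<And>j. snd (P j) \<le> Y"
    using incseq_convergent[OF inc, of y] lower by auto
  have X_ge: "x \<le> X" using LIMSEQ_le_const[OF X(1)] lower by auto
  have Y_le: "Y \<le> y" using LIMSEQ_le_const2[OF Y(1)] lower by auto
  have Y_pos: "0 < Y" using Y(2)[of 0] lower[of 0] by linarith
  have X_pos: "0 < X" using X_ge xy by linarith
  have lim: "(\<lambda>j. fst (P (Suc j))) \<longlonglongrightarrow> fst (bl_step k \<theta> lam (X, Y))"
    "(\<lambda>j. snd (P (Suc j))) \<longlonglongrightarrow> snd (bl_step k \<theta> lam (X, Y))"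
    unfolding P_Suc bl_step_def fst_conv snd_conv using X_pos Y_pos
    by (auto intro!: tendsto_intros X Y)
  have "bl_step k \<theta> lam (X, Y) = (X, Y)"
    using LIMSEQ_unique[OF lim(1) LIMSEQ_Suc[OF X(1)]] LIMSEQ_unique[OF lim(2) LIMSEQ_Suc[OF Y(1)]]
    by (simp add: prod_eq_iff)
  \<comment> \<open>Since x \<le> X and Y \<le> y, the limit is asymmetric with the same
    orientation, and uniqueness identifies it.\<close>
  then have "X = x \<and> Y = y"
    using asymmetric_fixed_point_unique[OF k th, of X Y x y] fp xy Y_pos X_ge Y_le by auto
  then show "(\<lambda>j. fst (P j)) \<longlonglongrightarrow> x" "(\<lambda>j. snd (P j)) \<longlonglongrightarrow> y"
    using X Y by auto
qed

section \<open>Cylinders of the configuration space\<close>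

definition cyl :: "nat \<Rightarrow> nat \<Rightarrow> (nat list \<Rightarrow> int) \<Rightarrow> (nat list \<Rightarrow> int) set" where
  "cyl k n \<sigma> = {\<omega> \<in> space (config_space k). \<forall>v\<in>ball_n k n. \<omega> v = \<sigma> v}"

lemma space_config_space: "space (config_space k) = PiE (cayley_V k) (\<lambda>_. spins)"
  by (simp add: config_space_def space_PiM)

lemma config_in_spins: "\<omega> \<in> space (config_space k) \<Longrightarrow> v \<in> cayley_V k \<Longrightarrow> \<omega> v \<in> spins"
  by (auto simp: space_config_space PiE_def Pi_def)

lemma restrict_in_PiE: 
  "\<omega> \<in> space (config_space k) \<Longrightarrow> restrict \<omega> (ball_n k n) \<in> PiE (ball_n k n) (\<lambda>_. spins)"
  using ball_n_subset[of k n] by (auto simp: config_in_spins)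

lemma finite_PiE_ball [simp]: "finite (PiE (ball_n k n) (\<lambda>_. spins))"
  by (simp add: finite_PiE)

lemma site_sets:
  assumes "v \<in> cayley_V k"
  shows "{\<omega> \<in> space (config_space k). P (\<omega> v)} \<in> sets (config_space k)"
proof -
  have "(\<lambda>\<omega>. \<omega> v) -` {s \<in> spins. P s} \<inter> space (config_space k) \<in> sets (config_space k)"
  proof (rule measurable_sets)
    show "(\<lambda>\<omega>. \<omega> v) \<in> measurable (config_space k) (count_space spins)"
      unfolding config_space_def using assms by (rule measurable_component_singleton)
  qed auto
  also have "(\<lambda>\<omega>. \<omega> v) -` {s \<in> spins. P s} \<inter> space (config_space k) =
      {\<omega> \<in> space (config_space k). P (\<omega> v)}"
    using assms config_in_spins by auto
  finally show ?thesis .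
qed

lemma ball_event_sets:
  "{\<omega> \<in> space (config_space k). \<forall>v\<in>ball_n k n. P v (\<omega> v)} \<in> sets (config_space k)"
  by (rule sets.sets_Collect_finite_All) (use ball_n_subset in \<open>auto intro!: site_sets\<close>)

lemma cyl_sets [simp]: "cyl k n \<sigma> \<in> sets (config_space k)"
  unfolding cyl_def by (rule ball_event_sets)

lemma disjoint_cyl: "disjoint_family_on (cyl k n) (PiE (ball_n k n) (\<lambda>_. spins))"
  unfolding disjoint_family_on_def cyl_def
  by (auto simp: PiE_iff extensional_def fun_eq_iff) metis

text \<open>Each \<omega> lies in the cylinder of its own restriction, so an event seen in a ball is
  a finite union of cylinders, disjoint by \<open>disjoint_cyl\<close>.\<close>

lemma UN_cyl:
  "(\<Union>\<sigma>\<in>{\<sigma> \<in> PiE (ball_n k n) (\<lambda>_. spins). Q \<sigma>}. cyl k n \<sigma>) =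
    {\<omega> \<in> space (config_space k). Q (restrict \<omega> (ball_n k n))}"
proof (intro set_eqI iffI)
  fix \<omega> assume "\<omega> \<in> (\<Union>\<sigma>\<in>{\<sigma> \<in> PiE (ball_n k n) (\<lambda>_. spins). Q \<sigma>}. cyl k n \<sigma>)"
  then obtain \<sigma> where \<sigma>: "\<sigma> \<in> PiE (ball_n k n) (\<lambda>_. spins)" "Q \<sigma>" "\<omega> \<in> cyl k n \<sigma>" by auto
  then have "restrict \<omega> (ball_n k n) = \<sigma>"
    by (auto simp: cyl_def fun_eq_iff PiE_iff extensional_def)
  with \<sigma> show "\<omega> \<in> {\<omega> \<in> space (config_space k). Q (restrict \<omega> (ball_n k n))}"
    by (auto simp: cyl_def)
next
  fix \<omega> assume "\<omega> \<in> {\<omega> \<in> space (config_space k). Q (restrict \<omega> (ball_n k n))}"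
  then show "\<omega> \<in> (\<Union>\<sigma>\<in>{\<sigma> \<in> PiE (ball_n k n) (\<lambda>_. spins). Q \<sigma>}. cyl k n \<sigma>)"
    by (intro UN_I[of "restrict \<omega> (ball_n k n)"]) (auto simp: cyl_def config_in_spins ball_n_subset[THEN subsetD])
qed

lemma measure_ball_event:
  assumes "prob_space M" "sets M = sets (config_space k)"
  shows "measure M {\<omega> \<in> space (config_space k). Q (restrict \<omega> (ball_n k n))} =
    (\<Sum>\<sigma>\<in>{\<sigma> \<in> PiE (ball_n k n) (\<lambda>_. spins). Q \<sigma>}. measure M (cyl k n \<sigma>))"
proof -
  interpret prob_space M by fact
  show ?thesis
    unfolding UN_cyl[symmetric]
    by (rule finite_measure_finite_Union)
      (use assms disjoint_cyl[of k n] in \<open>auto simp: disjoint_family_on_def\<close>)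
qed

text \<open>The empty set makes the family intersection-stable. The lower bound n0 is there because
  marginals are prescribed only for radius at least 1 and the kernel computation needs a ball larger
  than the one around \<Lambda>.\<close>

definition cyl_sets_from :: "nat \<Rightarrow> nat \<Rightarrow> (nat list \<Rightarrow> int) set set" where
  "cyl_sets_from k n0 = insert {} {cyl k n \<sigma> | n \<sigma>. n0 \<le> n \<and> \<sigma> \<in> PiE (ball_n k n) (\<lambda>_. spins)}"

lemma cyl_Int:
  assumes "m \<le> n" "\<tau> \<in> PiE (ball_n k n) (\<lambda>_. spins)"
  shows "cyl k m \<sigma> \<inter> cyl k n \<tau> = (if \<forall>v\<in>ball_n k m. \<sigma> v = \<tau> v then cyl k n \<tau> else {})"
  using ball_n_mono[OF assms(1), of k] by (auto simp: cyl_def subset_iff)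

text \<open>Cylinders over concentric balls are nested or disjoint.\<close>

lemma Int_stable_cyl: "Int_stable (cyl_sets_from k n0)"
proof (rule Int_stableI)
  fix a b assume ab: "a \<in> cyl_sets_from k n0" "b \<in> cyl_sets_from k n0"
  show "a \<inter> b \<in> cyl_sets_from k n0"
  proof (cases "a = {} \<or> b = {}")
    case True
    then show ?thesis by (auto simp: cyl_sets_from_def)
  next
    case False
    then obtain m \<sigma> n \<tau> where *: "a = cyl k m \<sigma>" "n0 \<le> m" "\<sigma> \<in> PiE (ball_n k m) (\<lambda>_. spins)"
      "b = cyl k n \<tau>" "n0 \<le> n" "\<tau> \<in> PiE (ball_n k n) (\<lambda>_. spins)"
      using ab by (auto simp: cyl_sets_from_def)
    have "a \<inter> b \<in> {{}, a, b}"
    proof (cases "m \<le> n")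
      case True
      then show ?thesis using cyl_Int[OF True *(6), of \<sigma>] * by auto
    next
      case False
      then show ?thesis using cyl_Int[OF _ *(3), of n \<tau>] * by (auto simp: Int_commute)
    qed
    then show ?thesis
      using ab by (auto simp: cyl_sets_from_def)
  qed
qed

lemma cyl_sets_from_Pow: "cyl_sets_from k n0 \<subseteq> Pow (space (config_space k))"
  by (auto simp: cyl_sets_from_def cyl_def)

lemma sets_config_space: "sets (config_space k) = sigma_sets (space (config_space k)) (cyl_sets_from k n0)"
proof
  show "sigma_sets (space (config_space k)) (cyl_sets_from k n0) \<subseteq> sets (config_space k)"
    by (rule sets.sigma_sets_subset) (auto simp: cyl_sets_from_def)
  interpret S: sigma_algebra "space (config_space k)" "sigma_sets (space (config_space k)) (cyl_sets_from k n0)"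
    by (rule sigma_algebra_sigma_sets[OF cyl_sets_from_Pow])
  have "{\<omega> \<in> PiE (cayley_V k) (\<lambda>_. spins). \<omega> i \<in> A} \<in> sigma_sets (space (config_space k)) (cyl_sets_from k n0)"
    if i: "i \<in> cayley_V k" for i A
  proof -
    \<comment> \<open>A radius that sees the site i and respects n0.\<close>
    define n where "n = max n0 (length i)"
    have i_ball: "i \<in> ball_n k n" using i by (simp add: ball_n_def n_def)
    have "{\<omega> \<in> PiE (cayley_V k) (\<lambda>_. spins). \<omega> i \<in> A} =
        {\<omega> \<in> space (config_space k). restrict \<omega> (ball_n k n) i \<in> A}"
      using i_ball by (simp add: space_config_space)
    also have "\<dots> = (\<Union>\<sigma>\<in>{\<sigma> \<in> PiE (ball_n k n) (\<lambda>_. spins). \<sigma> i \<in> A}. cyl k n \<sigma>)"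
      by (rule UN_cyl[symmetric])
    also have "\<dots> \<in> sigma_sets (space (config_space k)) (cyl_sets_from k n0)"
      by (intro S.finite_UN) (auto simp: cyl_sets_from_def n_def)
    finally show ?thesis .
  qed
  then have "sigma_sets (space (config_space k))
      {{\<omega> \<in> PiE (cayley_V k) (\<lambda>_. spins). \<omega> i \<in> A} | i A. i \<in> cayley_V k \<and> A \<in> sets (count_space spins)} \<subseteq>
      sigma_sets (space (config_space k)) (cyl_sets_from k n0)"
    by (intro sigma_sets_mono) blast
  then show "sets (config_space k) \<subseteq> sigma_sets (space (config_space k)) (cyl_sets_from k n0)"
    by (simp add: config_space_def sets_PiM_single space_PiM)
qed

lemma measure_eqI_cyl:
  assumes "prob_space M" "prob_space N" "sets M = sets (config_space k)" "sets N = sets (config_space k)"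
    and eq: "\<And>n \<sigma>. n \<ge> 1 \<Longrightarrow> \<sigma> \<in> PiE (ball_n k n) (\<lambda>_. spins) \<Longrightarrow> measure M (cyl k n \<sigma>) = measure N (cyl k n \<sigma>)"
  shows "M = N"
proof -
  interpret M: prob_space M by fact
  interpret N: prob_space N by fact
  show ?thesis
  proof (rule measure_eqI_generator_eq_countable[OF Int_stable_cyl[of k 1] cyl_sets_from_Pow])
    show "emeasure M X = emeasure N X" if "X \<in> cyl_sets_from k 1" for X
      using that eq by (auto simp: cyl_sets_from_def M.emeasure_eq_measure N.emeasure_eq_measure)
    show "sets M = sigma_sets (space (config_space k)) (cyl_sets_from k 1)"
      "sets N = sigma_sets (space (config_space k)) (cyl_sets_from k 1)"
      using assms sets_config_space by auto
    show "cyl k 1 ` PiE (ball_n k 1) (\<lambda>_. spins) \<subseteq> cyl_sets_from k 1"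
      by (auto simp: cyl_sets_from_def)
    show "\<Union> (cyl k 1 ` PiE (ball_n k 1) (\<lambda>_. spins)) = space (config_space k)"
      using UN_cyl[where Q = "\<lambda>_. True" and n = 1 and k = k] by simp
  qed (auto intro!: countable_finite)
qed

text \<open>Exactly one cylinder of radius n contains \<omega>; measurability and integrals of local
  functions are read off from this form.\<close>

lemma local_function_eq_sum:
  fixes f g :: "(nat list \<Rightarrow> int) \<Rightarrow> real"
  assumes "\<And>\<omega>. \<omega> \<in> space (config_space k) \<Longrightarrow> f \<omega> = g (restrict \<omega> (ball_n k n))"
    and "\<omega> \<in> space (config_space k)"
  shows "f \<omega> = (\<Sum>\<sigma>\<in>PiE (ball_n k n) (\<lambda>_. spins). g \<sigma> * indicator (cyl k n \<sigma>) \<omega>)"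
proof -
  let ?r = "restrict \<omega> (ball_n k n)"
  have "indicator (cyl k n \<sigma>) \<omega> = (if \<sigma> = ?r then 1 else (0::real))"
    if "\<sigma> \<in> PiE (ball_n k n) (\<lambda>_. spins)" for \<sigma>
  proof -
    have "\<omega> \<in> cyl k n \<sigma> \<longleftrightarrow> \<sigma> = ?r"
      using that assms(2) by (auto simp: cyl_def fun_eq_iff PiE_iff extensional_def)
    then show ?thesis by (simp add: indicator_def)
  qed
  then have "(\<Sum>\<sigma>\<in>PiE (ball_n k n) (\<lambda>_. spins). g \<sigma> * indicator (cyl k n \<sigma>) \<omega>) =
      (\<Sum>\<sigma>\<in>PiE (ball_n k n) (\<lambda>_. spins). if \<sigma> = ?r then g \<sigma> else 0)"
    by (intro sum.cong) auto
  also have "\<dots> = g ?r"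
    using restrict_in_PiE[OF assms(2), of n] by simp
  finally show ?thesis using assms by simp
qed

lemma borel_measurable_local:
  fixes f g :: "(nat list \<Rightarrow> int) \<Rightarrow> real"
  assumes "\<And>\<omega>. \<omega> \<in> space (config_space k) \<Longrightarrow> f \<omega> = g (restrict \<omega> (ball_n k n))"
  shows "f \<in> borel_measurable (config_space k)"
proof -
  have "(\<lambda>\<omega>. \<Sum>\<sigma>\<in>PiE (ball_n k n) (\<lambda>_. spins). g \<sigma> * indicator (cyl k n \<sigma>) \<omega>) \<in> borel_measurable (config_space k)"
    by (intro borel_measurable_sum borel_measurable_times borel_measurable_const borel_measurable_indicator cyl_sets)
  moreover have "f \<omega> = (\<Sum>\<sigma>\<in>PiE (ball_n k n) (\<lambda>_. spins). g \<sigma> * indicator (cyl k n \<sigma>) \<omega>)"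
    if "\<omega> \<in> space (config_space k)" for \<omega>
    using assms that by (rule local_function_eq_sum)
  ultimately show ?thesis
    by (subst measurable_cong)
qed

lemma integral_local:
  fixes f g :: "(nat list \<Rightarrow> int) \<Rightarrow> real"
  assumes "prob_space M" and M: "sets M = sets (config_space k)"
    and f: "\<And>\<omega>. \<omega> \<in> space (config_space k) \<Longrightarrow> f \<omega> = g (restrict \<omega> (ball_n k n))"
  shows "(\<integral>\<omega>. f \<omega> \<partial>M) = (\<Sum>\<sigma>\<in>PiE (ball_n k n) (\<lambda>_. spins). g \<sigma> * measure M (cyl k n \<sigma>))"
proof -
  interpret prob_space M by fact
  have [simp]: "cyl k n \<sigma> \<in> sets M" for \<sigma> using M by simp
  have "(\<integral>\<omega>. f \<omega> \<partial>M) = (\<integral>\<omega>. (\<Sum>\<sigma>\<in>PiE (ball_n k n) (\<lambda>_. spins). g \<sigma> * indicator (cyl k n \<sigma>) \<omega>) \<partial>M)"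
    by (intro Bochner_Integration.integral_cong refl local_function_eq_sum f)
      (use sets_eq_imp_space_eq[OF M] in auto)
  also have "\<dots> = (\<Sum>\<sigma>\<in>PiE (ball_n k n) (\<lambda>_. spins). \<integral>\<omega>. g \<sigma> * indicator (cyl k n \<sigma>) \<omega> \<partial>M)"
    by (intro Bochner_Integration.integral_sum integrable_mult_right integrable_real_indicator)
      (auto simp: emeasure_eq_measure)
  finally show ?thesis by simp
qed

section \<open>The specification\<close>

lemma spec_weight_eq:
  "spec_weight k \<theta> lam \<Lambda> \<eta> =
     (\<Prod>w\<in>{w \<in> cayley_V k. w \<noteq> [] \<and> (tl w \<in> \<Lambda> \<or> w \<in> \<Lambda>)}. inter_w \<theta> (\<eta> (tl w)) (\<eta> w)) *
     (\<Prod>v\<in>\<Lambda>. act_w lam (\<eta> v))"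
  unfolding spec_weight_def
  using prod_edges[where P = "\<lambda>u w. u \<in> \<Lambda> \<or> w \<in> \<Lambda>" and f = "\<lambda>e. inter_w \<theta> (\<eta> (fst e)) (\<eta> (snd e))"]
  by simp

text \<open>Edges leaving \<Lambda> end at most one level further out, hence the radius
  \<open>Suc m\<close>.\<close>

lemma spec_weight_cong:
  assumes "\<Lambda> \<subseteq> ball_n k m" "\<And>v. v \<in> ball_n k (Suc m) \<Longrightarrow> \<eta> v = \<eta>' v"
  shows "spec_weight k \<theta> lam \<Lambda> \<eta> = spec_weight k \<theta> lam \<Lambda> \<eta>'"
proof -
  have "w \<in> ball_n k (Suc m) \<and> tl w \<in> ball_n k (Suc m)"
    if "w \<in> cayley_V k" "w \<noteq> []" "tl w \<in> \<Lambda> \<or> w \<in> \<Lambda>" for w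
    using that assms(1) tl_in_cayley_V[of w k] by (auto simp: ball_n_def subset_iff)
  moreover have "v \<in> ball_n k (Suc m)" if "v \<in> \<Lambda>" for v
    using that assms(1) by (auto simp: ball_n_def subset_iff)
  ultimately show ?thesis
    unfolding spec_weight_eq by (intro arg_cong2[where f = "(*)"] prod.cong refl) (auto simp: assms(2))
qed

lemma merge_in_space:
  "\<sigma> \<in> PiE \<Lambda> (\<lambda>_. spins) \<Longrightarrow> \<Lambda> \<subseteq> cayley_V k \<Longrightarrow> \<omega> \<in> space (config_space k) \<Longrightarrow>
    merge_cfg \<Lambda> \<sigma> \<omega> \<in> space (config_space k)"
  by (auto simp: space_config_space merge_cfg_def PiE_iff extensional_def)

lemma measurable_merge_cfg:
  assumes "\<sigma> \<in> PiE \<Lambda> (\<lambda>_. spins)" "\<Lambda> \<subseteq> cayley_V k"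
  shows "merge_cfg \<Lambda> \<sigma> \<in> measurable (config_space k) (config_space k)"
  unfolding config_space_def
proof (rule measurable_PiM_single')
  fix i assume i: "i \<in> cayley_V k"
  show "(\<lambda>\<omega>. merge_cfg \<Lambda> \<sigma> \<omega> i) \<in> measurable (Pi\<^sub>M (cayley_V k) (\<lambda>_. count_space spins)) (count_space spins)"
  proof (cases "i \<in> \<Lambda>")
    case True
    then have "\<sigma> i \<in> spins" using assms by auto
    then show ?thesis using True by (simp add: merge_cfg_def)
  next
    case False
    then show ?thesis using i by (simp add: merge_cfg_def)
  qed
next
  show "merge_cfg \<Lambda> \<sigma> \<in> space (Pi\<^sub>M (cayley_V k) (\<lambda>_. count_space spins)) \<rightarrow>
      (\<Pi>\<^sub>E i\<in>cayley_V k. space (count_space spins))"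
    using merge_in_space[OF assms] by (auto simp: config_space_def space_PiM)
qed

context scwr
begin

lemma spec_weight_pos: "spec_weight k \<theta> lam \<Lambda> \<eta> > 0"
  unfolding spec_weight_def by (intro mult_pos_pos prod_pos) (auto simp: inter_w_pos act_w_pos)

definition wsum :: "nat list set \<Rightarrow> (nat list \<Rightarrow> int) \<Rightarrow> real" where
  "wsum \<Lambda> \<omega> = (\<Sum>\<sigma>\<in>PiE \<Lambda> (\<lambda>_. spins). spec_weight k \<theta> lam \<Lambda> (merge_cfg \<Lambda> \<sigma> \<omega>))"

lemma wsum_pos: "finite \<Lambda> \<Longrightarrow> wsum \<Lambda> \<omega> > 0"
  unfolding wsum_def
  by (intro sum_pos finite_PiE) (auto simp: spec_weight_pos PiE_eq_empty_iff, simp add: spins_def)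

definition kprob :: "nat list set \<Rightarrow> (nat list \<Rightarrow> int) \<Rightarrow> (nat list \<Rightarrow> int) \<Rightarrow> real" where
  "kprob \<Lambda> \<sigma> \<omega> = spec_weight k \<theta> lam \<Lambda> (merge_cfg \<Lambda> \<sigma> \<omega>) / wsum \<Lambda> \<omega>"

lemma spec_kernel_eq:
  "spec_kernel k \<theta> lam \<Lambda> A \<omega> = (\<Sum>\<sigma>\<in>PiE \<Lambda> (\<lambda>_. spins). kprob \<Lambda> \<sigma> \<omega> * indicator A (merge_cfg \<Lambda> \<sigma> \<omega>))"
  by (simp add: spec_kernel_def kprob_def wsum_def sum_divide_distrib)

lemma sum_kprob: "finite \<Lambda> \<Longrightarrow> (\<Sum>\<sigma>\<in>PiE \<Lambda> (\<lambda>_. spins). kprob \<Lambda> \<sigma> \<omega>) = 1"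
  using wsum_pos[of \<Lambda> \<omega>] by (simp add: kprob_def sum_divide_distrib[symmetric] wsum_def)

lemma kprob_pos: "finite \<Lambda> \<Longrightarrow> kprob \<Lambda> \<sigma> \<omega> > 0"
  by (simp add: kprob_def wsum_pos spec_weight_pos)

lemma kprob_le_1:
  assumes "finite \<Lambda>" "\<sigma> \<in> PiE \<Lambda> (\<lambda>_. spins)"
  shows "kprob \<Lambda> \<sigma> \<omega> \<le> 1"
proof -
  have "kprob \<Lambda> \<sigma> \<omega> \<le> (\<Sum>\<sigma>\<in>PiE \<Lambda> (\<lambda>_. spins). kprob \<Lambda> \<sigma> \<omega>)"
    using assms kprob_pos[OF assms(1)] by (intro member_le_sum) (auto simp: less_imp_le finite_PiE)
  then show ?thesis using sum_kprob[OF assms(1)] by simp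
qed

lemma spec_weight_local:
  assumes "\<Lambda> \<subseteq> ball_n k m"
  shows "spec_weight k \<theta> lam \<Lambda> (merge_cfg \<Lambda> \<sigma> \<omega>) =
    spec_weight k \<theta> lam \<Lambda> (merge_cfg \<Lambda> \<sigma> (restrict \<omega> (ball_n k (Suc m))))"
  by (rule spec_weight_cong[OF assms]) (auto simp: merge_cfg_def)

lemma borel_measurable_kprob:
  assumes "finite \<Lambda>" "\<Lambda> \<subseteq> cayley_V k"
  shows "kprob \<Lambda> \<sigma> \<in> borel_measurable (config_space k)"
proof -
  obtain m where "\<Lambda> \<subseteq> ball_n k m" using exhausting_ball[OF assms] .
  then have "kprob \<Lambda> \<sigma> \<omega> = kprob \<Lambda> \<sigma> (restrict \<omega> (ball_n k (Suc m)))" for \<omega>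
    unfolding kprob_def wsum_def by (simp only: spec_weight_local[of \<Lambda> m _ \<omega>])
  then show ?thesis
    by (rule borel_measurable_local)
qed

end

section \<open>Boundary laws give Gibbs measures\<close>

lemma tisgm_weight_eq:
  "tisgm_weight k \<theta> lam x y n \<eta> =
    tree_weight k \<theta> n (\<lambda>v s. if length v < n then act_w lam s else bl x y s) \<eta>"
proof -
  have "{w \<in> cayley_V k. w \<noteq> [] \<and> length w \<le> n} = ball_n k n - {[]}"
    by (auto simp: ball_n_def)
  then have 1: "(\<Prod>e\<in>{e \<in> cayley_E k. length (snd e) \<le> n}. inter_w \<theta> (\<eta> (fst e)) (\<eta> (snd e))) =
      (\<Prod>w\<in>ball_n k n - {[]}. inter_w \<theta> (\<eta> (tl w)) (\<eta> w))"
    using prod_edges[where P = "\<lambda>u w. length w \<le> n" and k = k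
        and f = "\<lambda>e. inter_w \<theta> (\<eta> (fst e)) (\<eta> (snd e))"] by simp
  let ?I = "{v \<in> cayley_V k. length v < n}" and ?L = "{v \<in> cayley_V k. length v = n}"
  have "ball_n k n = ?I \<union> ?L" by (auto simp: ball_n_def)
  moreover have "finite ?I" "finite ?L"
    by (rule finite_subset[OF _ finite_ball_n[of k n]]; auto simp: ball_n_def)+
  ultimately have "(\<Prod>v\<in>ball_n k n. if length v < n then act_w lam (\<eta> v) else bl x y (\<eta> v)) =
      (\<Prod>v\<in>?I. if length v < n then act_w lam (\<eta> v) else bl x y (\<eta> v)) *
      (\<Prod>v\<in>?L. if length v < n then act_w lam (\<eta> v) else bl x y (\<eta> v))"
    by (simp only:) (rule prod.union_disjoint, auto)
  also have "\<dots> = (\<Prod>v\<in>?I. act_w lam (\<eta> v)) * (\<Prod>v\<in>?L. bl x y (\<eta> v))"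
    by (intro arg_cong2[where f = "(*)"] prod.cong) auto
  finally show ?thesis
    unfolding tisgm_weight_def tree_weight_def 1 by (simp add: mult.assoc)
qed

text \<open>Inside \<open>\<Lambda>\<close> the finite-volume weight of the boundary law agrees with the Boltzmann weight
  up to a factor that only sees spins outside \<open>\<Lambda>\<close>.\<close>

lemma tisgm_weight_factor:
  assumes "\<Lambda> \<subseteq> ball_n k m" "m < n"
  obtains R where "\<And>\<sigma> \<eta>. tisgm_weight k \<theta> lam x y n (merge_cfg \<Lambda> \<sigma> \<eta>) =
    spec_weight k \<theta> lam \<Lambda> (merge_cfg \<Lambda> \<sigma> \<eta>) * R \<eta>"
proof
  fix \<sigma> \<eta>
  let ?\<eta> = "merge_cfg \<Lambda> \<sigma> \<eta>" and ?B = "ball_n k n"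
  let ?\<phi> = "\<lambda>v s. if length v < n then act_w lam s else bl x y s"
  have \<Lambda>: "v \<in> ?B" "length v < n" if "v \<in> \<Lambda>" for v
    using that assms by (auto simp: ball_n_def)
  \<comment> \<open>The edges meeting \<Lambda>, named by child. As m < n they stay inside the ball,
    and vertices of \<Lambda> carry the activity rather than the boundary law.\<close>
  let ?T = "{w \<in> cayley_V k. w \<noteq> [] \<and> (tl w \<in> \<Lambda> \<or> w \<in> \<Lambda>)}"
  have T: "?T \<subseteq> ?B - {[]}"
  proof
    fix w assume "w \<in> ?T"
    then have w: "w \<in> cayley_V k" "w \<noteq> []" "tl w \<in> \<Lambda> \<or> w \<in> \<Lambda>" by auto
    then have "length w \<le> n"
      using \<Lambda>(2)[of w] \<Lambda>(2)[of "tl w"] by (cases w) auto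
    then show "w \<in> ?B - {[]}" using w by (simp add: ball_n_def)
  qed
  have "(\<Prod>w\<in>?B - {[]}. inter_w \<theta> (?\<eta> (tl w)) (?\<eta> w)) =
      (\<Prod>w\<in>?B - {[]} - ?T. inter_w \<theta> (?\<eta> (tl w)) (?\<eta> w)) * (\<Prod>w\<in>?T. inter_w \<theta> (?\<eta> (tl w)) (?\<eta> w))"
    by (rule prod.subset_diff[OF T]) simp
  moreover have "(\<Prod>w\<in>?B - {[]} - ?T. inter_w \<theta> (?\<eta> (tl w)) (?\<eta> w)) =
      (\<Prod>w\<in>?B - {[]} - ?T. inter_w \<theta> (\<eta> (tl w)) (\<eta> w))"
    by (intro prod.cong) (auto simp: merge_cfg_def ball_n_def)
  moreover have "(\<Prod>v\<in>?B. ?\<phi> v (?\<eta> v)) = (\<Prod>v\<in>?B - \<Lambda>. ?\<phi> v (?\<eta> v)) * (\<Prod>v\<in>\<Lambda>. ?\<phi> v (?\<eta> v))"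
    by (rule prod.subset_diff) (use \<Lambda> in auto)
  moreover have "(\<Prod>v\<in>?B - \<Lambda>. ?\<phi> v (?\<eta> v)) = (\<Prod>v\<in>?B - \<Lambda>. ?\<phi> v (\<eta> v))"
    by (intro prod.cong) (auto simp: merge_cfg_def)
  moreover have "(\<Prod>v\<in>\<Lambda>. ?\<phi> v (?\<eta> v)) = (\<Prod>v\<in>\<Lambda>. act_w lam (?\<eta> v))"
    by (intro prod.cong) (use \<Lambda>(2) in auto)
  ultimately show "tisgm_weight k \<theta> lam x y n ?\<eta> = spec_weight k \<theta> lam \<Lambda> ?\<eta> *
      ((\<Prod>w\<in>?B - {[]} - ?T. inter_w \<theta> (\<eta> (tl w)) (\<eta> w)) * (\<Prod>v\<in>?B - \<Lambda>. ?\<phi> v (\<eta> v)))"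
    by (simp add: tisgm_weight_eq tree_weight_def spec_weight_eq mult_ac)
qed

context scwr
begin

text \<open>Given the spins outside \<Lambda>, the prescribed weight is the Boltzmann weight times a
  constant R, so the kernel averages over exactly this conditional law.\<close>

lemma integral_spec_kernel_cyl:
  assumes \<mu>: "tisgm_of k \<theta> lam x y \<mu>" and \<Lambda>: "\<Lambda> \<subseteq> ball_n k m" and n: "m < n"
    and \<tau>: "\<tau> \<in> PiE (ball_n k n) (\<lambda>_. spins)"
  shows "(\<integral>\<omega>. spec_kernel k \<theta> lam \<Lambda> (cyl k n \<tau>) \<omega> \<partial>\<mu>) = measure \<mu> (cyl k n \<tau>)"
proof -
  have P: "prob_space \<mu>" "sets \<mu> = sets (config_space k)"
    using \<mu> by (auto simp: tisgm_of_def)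
  have fin: "finite \<Lambda>" using finite_subset[OF \<Lambda>] by simp
  have \<Lambda>V: "\<Lambda> \<subseteq> cayley_V k" and \<Lambda>n: "\<Lambda> \<subseteq> ball_n k n"
    using \<Lambda> ball_n_subset[of k m] ball_n_mono[of m n k] n by auto
  obtain R where R: "\<And>\<sigma> \<eta>. tisgm_weight k \<theta> lam x y n (merge_cfg \<Lambda> \<sigma> \<eta>) =
      spec_weight k \<theta> lam \<Lambda> (merge_cfg \<Lambda> \<sigma> \<eta>) * R \<eta>"
    using tisgm_weight_factor[OF \<Lambda> n] by metis
  define Z where "Z = (\<Sum>\<tau>\<in>PiE (ball_n k n) (\<lambda>_. spins). tisgm_weight k \<theta> lam x y n \<tau>)"
  define T where "T = tisgm_weight k \<theta> lam x y n"
  \<comment> \<open>Unlike the indicator of the cylinder, D does not ask for membership in the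
    configuration space, so it can be evaluated on restricted configurations.\<close>
  define D where "D = (\<lambda>\<zeta>. if \<forall>v\<in>ball_n k n. \<zeta> v = \<tau> v then 1 else (0::real))"
  define W where "W = spec_weight k \<theta> lam \<Lambda>"
  have cyl: "measure \<mu> (cyl k n \<sigma>) = T \<sigma> / Z" if "\<sigma> \<in> PiE (ball_n k n) (\<lambda>_. spins)" for \<sigma>
    using \<mu> n that by (auto simp: tisgm_of_def cyl_def Z_def T_def)
  define g where "g = (\<lambda>\<zeta>. (\<Sum>\<sigma>\<in>PiE \<Lambda> (\<lambda>_. spins). W (merge_cfg \<Lambda> \<sigma> \<zeta>) * D (merge_cfg \<Lambda> \<sigma> \<zeta>)) / wsum \<Lambda> \<zeta>)"
  have loc: "W (merge_cfg \<Lambda> \<sigma> \<omega>) = W (merge_cfg \<Lambda> \<sigma> (restrict \<omega> (ball_n k n)))" for \<sigma> \<omega>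
    unfolding W_def by (rule spec_weight_cong[OF \<Lambda>]) (use n in \<open>auto simp: merge_cfg_def ball_n_def\<close>)
  have "spec_kernel k \<theta> lam \<Lambda> (cyl k n \<tau>) \<omega> = g (restrict \<omega> (ball_n k n))"
    if "\<omega> \<in> space (config_space k)" for \<omega>
  proof -
    have "indicator (cyl k n \<tau>) (merge_cfg \<Lambda> \<sigma> \<omega>) = D (merge_cfg \<Lambda> \<sigma> (restrict \<omega> (ball_n k n)))"
      if "\<sigma> \<in> PiE \<Lambda> (\<lambda>_. spins)" for \<sigma>
      using merge_in_space[OF that \<Lambda>V \<open>\<omega> \<in> _\<close>]
      by (auto simp: indicator_def cyl_def D_def merge_cfg_def)
    then show ?thesis
      unfolding spec_kernel_def g_def wsum_def W_def[symmetric]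
      by (simp add: loc[of _ \<omega>])
  qed
  then have "(\<integral>\<omega>. spec_kernel k \<theta> lam \<Lambda> (cyl k n \<tau>) \<omega> \<partial>\<mu>) =
      (\<Sum>\<sigma>\<in>PiE (ball_n k n) (\<lambda>_. spins). g \<sigma> * measure \<mu> (cyl k n \<sigma>))"
    by (rule integral_local[OF P])
  also have "\<dots> = (\<Sum>\<sigma>\<in>PiE (ball_n k n) (\<lambda>_. spins). g \<sigma> * (T \<sigma> / Z))"
    by (intro sum.cong) (auto simp: cyl)
  also have "\<dots> = (\<Sum>\<sigma>\<in>PiE (ball_n k n) (\<lambda>_. spins). D \<sigma> * (T \<sigma> / Z))"
  proof -
    have split: "(\<Sum>\<sigma>\<in>PiE (ball_n k n) (\<lambda>_. spins). f \<sigma>) =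
        (\<Sum>\<zeta>\<in>PiE (ball_n k n - \<Lambda>) (\<lambda>_. spins). \<Sum>\<sigma>\<in>PiE \<Lambda> (\<lambda>_. spins). f (merge_cfg \<Lambda> \<sigma> \<zeta>))"
      for f :: "_ \<Rightarrow> real"
    proof -
      have "\<Lambda> \<union> (ball_n k n - \<Lambda>) = ball_n k n" using \<Lambda>n by auto
      then show ?thesis
        using sum_PiE_Un[where A = \<Lambda> and B = "ball_n k n - \<Lambda>" and S = spins and f = f] by (subst sum.swap) simp
    qed
    \<comment> \<open>The kernel does not see the spins inside \<Lambda>, so it leaves the inner
      sum, which then cancels its denominator \<open>wsum\<close>.\<close>
    have g: "g (merge_cfg \<Lambda> \<sigma> \<zeta>) = g \<zeta>" for \<sigma> \<zeta>
    proof -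
      have "merge_cfg \<Lambda> \<sigma>' (merge_cfg \<Lambda> \<sigma> \<zeta>) = merge_cfg \<Lambda> \<sigma>' \<zeta>" for \<sigma>'
        by (auto simp: merge_cfg_def)
      then show ?thesis by (simp add: g_def wsum_def)
    qed
    have "(\<Sum>\<sigma>\<in>PiE \<Lambda> (\<lambda>_. spins). g (merge_cfg \<Lambda> \<sigma> \<zeta>) * (T (merge_cfg \<Lambda> \<sigma> \<zeta>) / Z)) =
        (\<Sum>\<sigma>\<in>PiE \<Lambda> (\<lambda>_. spins). D (merge_cfg \<Lambda> \<sigma> \<zeta>) * (T (merge_cfg \<Lambda> \<sigma> \<zeta>) / Z))" for \<zeta>
    proof -
      have "(\<Sum>\<sigma>\<in>PiE \<Lambda> (\<lambda>_. spins). g (merge_cfg \<Lambda> \<sigma> \<zeta>) * (T (merge_cfg \<Lambda> \<sigma> \<zeta>) / Z)) =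
          (\<Sum>\<sigma>\<in>PiE \<Lambda> (\<lambda>_. spins). W (merge_cfg \<Lambda> \<sigma> \<zeta>) * (g \<zeta> * R \<zeta> / Z))"
        by (simp add: g T_def W_def R mult_ac)
      also have "\<dots> = wsum \<Lambda> \<zeta> * (g \<zeta> * R \<zeta> / Z)"
        unfolding wsum_def W_def by (rule sum_distrib_right[symmetric])
      also have "\<dots> = (\<Sum>\<sigma>\<in>PiE \<Lambda> (\<lambda>_. spins). W (merge_cfg \<Lambda> \<sigma> \<zeta>) * D (merge_cfg \<Lambda> \<sigma> \<zeta>)) * (R \<zeta> / Z)"
        using wsum_pos[OF fin, of \<zeta>] by (simp add: g_def)
      also have "\<dots> = (\<Sum>\<sigma>\<in>PiE \<Lambda> (\<lambda>_. spins). D (merge_cfg \<Lambda> \<sigma> \<zeta>) * (T (merge_cfg \<Lambda> \<sigma> \<zeta>) / Z))"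
        unfolding sum_distrib_right by (intro sum.cong) (simp_all add: T_def W_def R mult_ac)
      finally show ?thesis .
    qed
    then show ?thesis unfolding split by simp
  qed
  also have "\<dots> = (\<Sum>\<sigma>\<in>PiE (ball_n k n) (\<lambda>_. spins). if \<sigma> = \<tau> then T \<tau> / Z else 0)"
  proof (intro sum.cong refl)
    fix \<sigma> assume "\<sigma> \<in> PiE (ball_n k n) (\<lambda>_. spins)"
    then have "(\<forall>v\<in>ball_n k n. \<sigma> v = \<tau> v) \<longleftrightarrow> \<sigma> = \<tau>"
      using \<tau> by (auto simp: fun_eq_iff PiE_iff extensional_def)
    then show "D \<sigma> * (T \<sigma> / Z) = (if \<sigma> = \<tau> then T \<tau> / Z else 0)"
      by (simp add: D_def)
  qed
  also have "\<dots> = measure \<mu> (cyl k n \<tau>)"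
    using \<tau> by (simp add: cyl)
  finally show ?thesis .
qed

text \<open>Both sides are finite measures in A of total mass 1 that agree on large cylinders, so a
  Dynkin argument applies.\<close>

lemma integral_spec_kernel:
  assumes \<mu>: "tisgm_of k \<theta> lam x y \<mu>" and \<Lambda>: "finite \<Lambda>" "\<Lambda> \<subseteq> cayley_V k"
    and A: "A \<in> sets (config_space k)"
  shows "(\<integral>\<omega>. spec_kernel k \<theta> lam \<Lambda> A \<omega> \<partial>\<mu>) = measure \<mu> A"
proof -
  have P: "prob_space \<mu>" and S: "sets \<mu> = sets (config_space k)"
    using \<mu> by (auto simp: tisgm_of_def)
  interpret prob_space \<mu> by fact
  note [measurable_cong] = S
  have sp: "space \<mu> = space (config_space k)" by (rule sets_eq_imp_space_eq[OF S])
  obtain m where m: "\<Lambda> \<subseteq> ball_n k m" using exhausting_ball[OF \<Lambda>] .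
  let ?\<Sigma> = "PiE \<Lambda> (\<lambda>_. spins)"
  have fin: "finite ?\<Sigma>" using \<Lambda> by (simp add: finite_PiE)
  \<comment> \<open>The share of the inner configuration \<sigma>, built as a genuine measure so
    that countable additivity in A comes for free.\<close>
  define Q where "Q \<sigma> = distr (density \<mu> (\<lambda>\<omega>. ennreal (kprob \<Lambda> \<sigma> \<omega>))) (config_space k) (merge_cfg \<Lambda> \<sigma>)" for \<sigma>
  have meas [measurable]: "kprob \<Lambda> \<sigma> \<in> borel_measurable \<mu>" for \<sigma>
    using borel_measurable_kprob[OF \<Lambda>, of \<sigma>] S by (simp cong: measurable_cong_sets)
  have merge [measurable]: "merge_cfg \<Lambda> \<sigma> \<in> measurable \<mu> (config_space k)" if "\<sigma> \<in> ?\<Sigma>" for \<sigma>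
    using measurable_merge_cfg[OF that \<Lambda>(2)] S by (simp cong: measurable_cong_sets)
  have int: "integrable \<mu> (\<lambda>\<omega>. kprob \<Lambda> \<sigma> \<omega> * indicator B (merge_cfg \<Lambda> \<sigma> \<omega>))"
    if "\<sigma> \<in> ?\<Sigma>" "B \<in> sets (config_space k)" for \<sigma> B
  proof (rule integrable_const_bound[where B = 1])
    show "AE \<omega> in \<mu>. norm (kprob \<Lambda> \<sigma> \<omega> * indicator B (merge_cfg \<Lambda> \<sigma> \<omega>)) \<le> 1"
      using kprob_le_1[OF \<Lambda>(1) that(1)] kprob_pos[OF \<Lambda>(1)] 
      by (auto simp: indicator_def abs_of_pos)
    show "(\<lambda>\<omega>. kprob \<Lambda> \<sigma> \<omega> * indicator B (merge_cfg \<Lambda> \<sigma> \<omega>)) \<in> borel_measurable \<mu>"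
      using measurable_compose[OF merge[OF that(1)] borel_measurable_indicator[OF that(2)]] meas
      by (rule borel_measurable_times[rotated])
  qed
  have Q_em: "emeasure (Q \<sigma>) B = ennreal (\<integral>\<omega>. kprob \<Lambda> \<sigma> \<omega> * indicator B (merge_cfg \<Lambda> \<sigma> \<omega>) \<partial>\<mu>)"
    if "\<sigma> \<in> ?\<Sigma>" "B \<in> sets (config_space k)" for \<sigma> B
  proof -
    have pre: "merge_cfg \<Lambda> \<sigma> -` B \<inter> space \<mu> \<in> sets \<mu>"
      using merge[OF that(1)] that(2) by (rule measurable_sets)
    have "emeasure (Q \<sigma>) B = emeasure (density \<mu> (\<lambda>\<omega>. ennreal (kprob \<Lambda> \<sigma> \<omega>))) (merge_cfg \<Lambda> \<sigma> -` B \<inter> space \<mu>)"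
      unfolding Q_def using that merge by (subst emeasure_distr) auto
    also have "\<dots> = (\<integral>\<^sup>+\<omega>. ennreal (kprob \<Lambda> \<sigma> \<omega>) * indicator (merge_cfg \<Lambda> \<sigma> -` B \<inter> space \<mu>) \<omega> \<partial>\<mu>)"
      using pre by (subst emeasure_density) auto
    also have "\<dots> = (\<integral>\<^sup>+\<omega>. ennreal (kprob \<Lambda> \<sigma> \<omega> * indicator B (merge_cfg \<Lambda> \<sigma> \<omega>)) \<partial>\<mu>)"
      by (intro nn_integral_cong) (auto simp: indicator_def)
    also have "\<dots> = ennreal (\<integral>\<omega>. kprob \<Lambda> \<sigma> \<omega> * indicator B (merge_cfg \<Lambda> \<sigma> \<omega>) \<partial>\<mu>)"
      using kprob_pos[OF \<Lambda>(1)] by (intro nn_integral_eq_integral int that) (auto simp: less_imp_le)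
    finally show ?thesis .
  qed
  have Q_sets: "sets (Q \<sigma>) = sets (config_space k)" for \<sigma> by (simp add: Q_def)
  have Q_space: "space (Q \<sigma>) = space (config_space k)" for \<sigma> by (simp add: Q_def)
  have Q_fin: "finite_measure (Q \<sigma>)" if "\<sigma> \<in> ?\<Sigma>" for \<sigma>
    by (rule finite_measureI) (simp add: Q_space Q_em[OF that])
  have Q_meas: "measure (Q \<sigma>) B = (\<integral>\<omega>. kprob \<Lambda> \<sigma> \<omega> * indicator B (merge_cfg \<Lambda> \<sigma> \<omega>) \<partial>\<mu>)"
    if "\<sigma> \<in> ?\<Sigma>" "B \<in> sets (config_space k)" for \<sigma> B
    unfolding measure_def Q_em[OF that] using kprob_pos[OF \<Lambda>(1)]
    by (intro enn2real_ennreal integral_nonneg_AE) (auto simp: less_imp_le)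
  have kern: "(\<integral>\<omega>. spec_kernel k \<theta> lam \<Lambda> B \<omega> \<partial>\<mu>) = (\<Sum>\<sigma>\<in>?\<Sigma>. measure (Q \<sigma>) B)"
    if "B \<in> sets (config_space k)" for B
    unfolding spec_kernel_eq using that int
    by (subst Bochner_Integration.integral_sum) (auto simp: Q_meas)
  have total: "(\<Sum>\<sigma>\<in>?\<Sigma>. measure (Q \<sigma>) (space (config_space k))) = 1"
  proof -
    have "spec_kernel k \<theta> lam \<Lambda> (space (config_space k)) \<omega> = 1" if "\<omega> \<in> space \<mu>" for \<omega>
      using that merge_in_space[OF _ \<Lambda>(2)] sum_kprob[OF \<Lambda>(1), of \<omega>] by (simp add: spec_kernel_eq sp)
    then have "(\<integral>\<omega>. spec_kernel k \<theta> lam \<Lambda> (space (config_space k)) \<omega> \<partial>\<mu>) = (\<integral>\<omega>. 1 \<partial>\<mu>)"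
      by (intro Bochner_Integration.integral_cong) auto
    then show ?thesis using kern[of "space (config_space k)"] prob_space by simp
  qed
  \<comment> \<open>Only radii above m generate here, since the cylinder computation requires m <
    n.\<close>
  have "A \<in> sigma_sets (space (config_space k)) (cyl_sets_from k (Suc m))"
    using A sets_config_space by auto
  with Int_stable_cyl cyl_sets_from_Pow
  have "(\<Sum>\<sigma>\<in>?\<Sigma>. measure (Q \<sigma>) A) = measure \<mu> A"
  proof (induction rule: sigma_sets_induct_disjoint)
    case (basic B)
    then show ?case
      using integral_spec_kernel_cyl[OF \<mu> m] kern by (auto simp: cyl_sets_from_def)
  next
    case empty
    show ?case by simp
  next
    case (compl B)
    then have B: "B \<in> sets (config_space k)" using sets_config_space by auto
    have "(\<Sum>\<sigma>\<in>?\<Sigma>. measure (Q \<sigma>) (space (config_space k) - B)) =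
        (\<Sum>\<sigma>\<in>?\<Sigma>. measure (Q \<sigma>) (space (config_space k)) - measure (Q \<sigma>) B)"
      using finite_measure.finite_measure_compl[OF Q_fin] B by (intro sum.cong) (auto simp: Q_sets Q_space)
    also have "\<dots> = 1 - measure \<mu> B"
      using compl total by (simp add: sum_subtractf)
    also have "\<dots> = measure \<mu> (space (config_space k) - B)"
      using prob_compl[of B] B by (simp add: S sp)
    finally show ?case .
  next
    case (union B)
    then have B: "range B \<subseteq> sets (config_space k)" using sets_config_space by auto
    have "(\<lambda>i. \<Sum>\<sigma>\<in>?\<Sigma>. measure (Q \<sigma>) (B i)) sums (\<Sum>\<sigma>\<in>?\<Sigma>. measure (Q \<sigma>) (\<Union>i. B i))"
      using finite_measure.finite_measure_UNION[OF Q_fin] B union(1) by (intro sums_sum) (auto simp: Q_sets)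
    moreover have "(\<lambda>i. measure \<mu> (B i)) sums measure \<mu> (\<Union>i. B i)"
      using B union(1) by (intro finite_measure_UNION) (auto simp: S)
    ultimately show ?case
      using union(3) by (simp add: sums_unique2)
  qed
  then show ?thesis using kern[OF A] by simp
qed

text \<open>The kernel is proper: an event B outside \<Lambda> can be pulled out of it, which
  reduces the claim to the integrated equation for \<open>A \<inter> B\<close>.\<close>

lemma tisgm_is_gibbs:
  assumes \<mu>: "tisgm_of k \<theta> lam x y \<mu>"
  shows "is_gibbs k \<theta> lam \<mu>"
proof -
  have P: "prob_space \<mu>" and S: "sets \<mu> = sets (config_space k)"
    using \<mu> by (auto simp: tisgm_of_def)
  have sp: "space \<mu> = space (config_space k)" by (rule sets_eq_imp_space_eq[OF S])
  have "measure \<mu> (A \<inter> B) = set_lebesgue_integral \<mu> B (spec_kernel k \<theta> lam \<Lambda> A)"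
    if \<Lambda>: "finite \<Lambda>" "\<Lambda> \<subseteq> cayley_V k" and A: "A \<in> sets (config_space k)" and B: "B \<in> outer_sets k \<Lambda>"
    for \<Lambda> A B
  proof -
    let ?r = "\<lambda>\<omega>. restrict \<omega> (cayley_V k - \<Lambda>)"
    let ?N = "Pi\<^sub>M (cayley_V k - \<Lambda>) (\<lambda>_. count_space spins)"
    have r: "?r \<in> measurable (config_space k) ?N"
      unfolding config_space_def by (rule measurable_restrict_subset) auto
    have "?r \<in> space (config_space k) \<rightarrow> space ?N"
      using measurable_space[OF r] by auto
    then obtain C where C: "C \<in> sets ?N" "B = ?r -` C \<inter> space (config_space k)"
      using B unfolding outer_sets_def by (auto simp: sets_vimage_algebra2)
    have B_sets: "B \<in> sets (config_space k)"
      unfolding C(2) by (rule measurable_sets[OF r C(1)])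
    have "merge_cfg \<Lambda> \<sigma> \<omega> \<in> B \<longleftrightarrow> \<omega> \<in> B" if "\<sigma> \<in> PiE \<Lambda> (\<lambda>_. spins)" "\<omega> \<in> space (config_space k)" for \<sigma> \<omega>
    proof -
      have "?r (merge_cfg \<Lambda> \<sigma> \<omega>) = ?r \<omega>" by (auto simp: merge_cfg_def fun_eq_iff)
      then show ?thesis using merge_in_space[OF that(1) \<Lambda>(2) that(2)] that(2) by (simp add: C(2))
    qed
    then have "spec_kernel k \<theta> lam \<Lambda> (A \<inter> B) \<omega> = indicator B \<omega> *\<^sub>R spec_kernel k \<theta> lam \<Lambda> A \<omega>"
      if "\<omega> \<in> space \<mu>" for \<omega>
      using that unfolding spec_kernel_eq sp by (auto simp: indicator_def intro!: sum.cong sum.neutral)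
    then have "set_lebesgue_integral \<mu> B (spec_kernel k \<theta> lam \<Lambda> A) = (\<integral>\<omega>. spec_kernel k \<theta> lam \<Lambda> (A \<inter> B) \<omega> \<partial>\<mu>)"
      unfolding set_lebesgue_integral_def by (intro Bochner_Integration.integral_cong) auto
    then show ?thesis
      using integral_spec_kernel[OF \<mu> \<Lambda>, of "A \<inter> B"] A B_sets by simp
  qed
  then show ?thesis using P S by (simp add: is_gibbs_def)
qed

end

section \<open>Maximality and extremality\<close>

context scwr
begin

text \<open>Here \<open>fst p\<close> always weighs the top spin e and \<open>snd p\<close> the
  bottom spin -e; the orientation enters only through \<open>e * s\<close>.\<close>

definition mess :: "real \<times> real \<Rightarrow> nat \<Rightarrow> nat list \<Rightarrow> int \<Rightarrow> real" where
  "mess p N v s = (if length v < N then act_w lam s else bl (fst p) (snd p) (e * s))"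

text \<open>Thresholds are arbitrary integers: one at most -1 imposes nothing and one above 1 makes
  the event empty, so a threshold can be shifted freely.\<close>

definition up_event :: "nat \<Rightarrow> (nat list \<Rightarrow> int) \<Rightarrow> (nat list \<Rightarrow> int) set" where
  "up_event n a = {\<omega> \<in> space (config_space k). \<forall>v\<in>ball_n k n. a v \<le> e * \<omega> v}"

text \<open>The site factors of the indicator of \<open>up_event\<close>, set to 1 outside the small
  ball so that they serve every larger volume.\<close>

definition up_ind :: "nat \<Rightarrow> (nat list \<Rightarrow> int) \<Rightarrow> nat list \<Rightarrow> int \<Rightarrow> real" where
  "up_ind n a v s = (if v \<in> ball_n k n \<and> \<not> a v \<le> e * s then 0 else 1)"

text \<open>The finite-volume probability of \<open>up_event\<close> in radius N with message p on
  the boundary.\<close>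

definition up_ratio :: "nat \<Rightarrow> (nat list \<Rightarrow> int) \<Rightarrow> nat \<Rightarrow> real \<times> real \<Rightarrow> real" where
  "up_ratio n a N p = tree_Z k \<theta> N (\<lambda>v s. mess p N v s * up_ind n a v s) / tree_Z k \<theta> N (mess p N)"

lemma up_event_sets: "up_event n a \<in> sets (config_space k)"
  unfolding up_event_def by (rule ball_event_sets)

lemma incr_up_ind: "incr (up_ind n a v)"
  by (auto simp: incr_def mlr_def up_ind_def)

lemma prod_up_ind:
  assumes "n \<le> N"
  shows "(\<Prod>v\<in>ball_n k N. up_ind n a v (\<sigma> v)) = (if \<forall>v\<in>ball_n k n. a v \<le> e * \<sigma> v then 1 else 0)"
proof (cases "\<forall>v\<in>ball_n k n. a v \<le> e * \<sigma> v")
  case True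
  then have "(\<Prod>v\<in>ball_n k N. up_ind n a v (\<sigma> v)) = 1"
    by (intro prod.neutral) (auto simp: up_ind_def)
  then show ?thesis using True by simp
next
  case False
  then obtain v where v: "v \<in> ball_n k n" "\<not> a v \<le> e * \<sigma> v" by auto
  then have "v \<in> ball_n k N" "up_ind n a v (\<sigma> v) = 0"
    using ball_n_mono[OF assms, of k] by (auto simp: up_ind_def)
  then have "(\<Prod>v\<in>ball_n k N. up_ind n a v (\<sigma> v)) = 0"
    by (intro prod_zero) auto
  then show ?thesis using False by (simp only: if_False)
qed

section \<open>Kernels of balls under boundary conditions\<close>

lemma tree_weight_mult:
  "tree_weight k \<theta> N (\<lambda>v s. \<phi> v s * h v s) \<sigma> = tree_weight k \<theta> N \<phi> \<sigma> * (\<Prod>v\<in>ball_n k N. h v (\<sigma> v))"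
  by (simp add: tree_weight_def prod.distrib)

lemma tree_Z_cong:
  assumes "\<And>v s. v \<in> ball_n k N \<Longrightarrow> s \<in> spins \<Longrightarrow> \<phi> v s = \<phi>' v s"
  shows "tree_Z k \<theta> N \<phi> = tree_Z k \<theta> N \<phi>'"
  unfolding tree_Z_def tree_weight_def
  by (intro sum.cong arg_cong2[where f = "(*)"] prod.cong refl assms) auto

lemma tree_Z_scale: "tree_Z k \<theta> N (\<lambda>v s. c v * \<phi> v s) = (\<Prod>v\<in>ball_n k N. c v) * tree_Z k \<theta> N \<phi>"
  unfolding tree_Z_def tree_weight_def sum_distrib_left by (simp add: prod.distrib mult_ac)

text \<open>A boundary condition acts only on the outermost level, through the edges to its
  children, so the Boltzmann weight keeps the tree format.\<close>

lemma spec_weight_ball: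
  "spec_weight k \<theta> lam (ball_n k N) (merge_cfg (ball_n k N) \<sigma> \<omega>) =
    tree_weight k \<theta> N (\<lambda>v s. act_w lam s *
      (if length v = N then \<Prod>c\<in>children k v. inter_w \<theta> s (\<omega> c) else 1)) \<sigma>"
proof -
  let ?B = "ball_n k N" and ?m = "merge_cfg (ball_n k N) \<sigma> \<omega>"
  have "{w \<in> cayley_V k. w \<noteq> [] \<and> (tl w \<in> ?B \<or> w \<in> ?B)} = (?B - {[]}) \<union> level k (Suc N)"
    using tl_in_cayley_V[of _ k] by (auto simp: ball_n_def level_def)
  moreover have "(?B - {[]}) \<inter> level k (Suc N) = {}"
    using ball_n_level_disjoint by blast
  ultimately have "(\<Prod>w\<in>{w \<in> cayley_V k. w \<noteq> [] \<and> (tl w \<in> ?B \<or> w \<in> ?B)}. inter_w \<theta> (?m (tl w)) (?m w)) =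
      (\<Prod>w\<in>?B - {[]}. inter_w \<theta> (?m (tl w)) (?m w)) * (\<Prod>w\<in>level k (Suc N). inter_w \<theta> (?m (tl w)) (?m w))"
    by (simp add: prod.union_disjoint)
  also have "(\<Prod>w\<in>?B - {[]}. inter_w \<theta> (?m (tl w)) (?m w)) = (\<Prod>w\<in>?B - {[]}. inter_w \<theta> (\<sigma> (tl w)) (\<sigma> w))"
    using tl_in_cayley_V[of _ k] by (intro prod.cong) (auto simp: merge_cfg_def ball_n_def)
  also have "(\<Prod>w\<in>level k (Suc N). inter_w \<theta> (?m (tl w)) (?m w)) =
      (\<Prod>v\<in>level k N. \<Prod>c\<in>children k v. inter_w \<theta> (\<sigma> v) (\<omega> c))"
    unfolding prod_level_Suc
  proof (intro prod.cong refl)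
    fix v w assume vw: "v \<in> level k N" "w \<in> children k v"
    then have "length w = Suc N" by (cases w) (auto simp: level_def children_def)
    then show "inter_w \<theta> (?m (tl w)) (?m w) = inter_w \<theta> (\<sigma> v) (\<omega> w)"
      using vw by (auto simp: merge_cfg_def ball_n_def level_def children_def)
  qed
  finally show ?thesis
    unfolding spec_weight_eq tree_weight_def
    by (simp add: prod.distrib prod_level_ball merge_cfg_def mult_ac)
qed

lemma spec_kernel_up_event:
  assumes "\<omega> \<in> space (config_space k)" "n \<le> N"
  defines "\<psi> \<equiv> \<lambda>v s. act_w lam s * (if length v = N then \<Prod>c\<in>children k v. inter_w \<theta> s (\<omega> c) else 1)"
  shows "spec_kernel k \<theta> lam (ball_n k N) (up_event n a) \<omega> =
    tree_Z k \<theta> N (\<lambda>v s. \<psi> v s * up_ind n a v s) / tree_Z k \<theta> N \<psi>"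
proof -
  have "indicator (up_event n a) (merge_cfg (ball_n k N) \<sigma> \<omega>) = (\<Prod>v\<in>ball_n k N. up_ind n a v (\<sigma> v))"
    if "\<sigma> \<in> PiE (ball_n k N) (\<lambda>_. spins)" for \<sigma>
    using merge_in_space[OF that ball_n_subset assms(1)] ball_n_mono[OF assms(2), of k]
    unfolding prod_up_ind[OF assms(2)] by (auto simp: indicator_def up_event_def merge_cfg_def)
  then show ?thesis
    unfolding spec_kernel_def tree_Z_def tree_weight_mult spec_weight_ball \<psi>_def
    by simp
qed

lemma mess_pos: "0 < fst p \<Longrightarrow> 0 < snd p \<Longrightarrow> mess p N v s > 0"
  by (simp add: mess_def act_w_pos bl_def)

text \<open>Replacing all outside spins by e raises the outer site factors in likelihood ratio. A
  vertex with k such children gets weight lam at e, lam \<theta>^k at -e and 1 at 0: the origin of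
  the starting pair.\<close>

lemma spec_kernel_up_event_le:
  assumes \<omega>: "\<omega> \<in> space (config_space k)" and n: "n \<le> N" "1 \<le> N"
  shows "spec_kernel k \<theta> lam (ball_n k N) (up_event n a) \<omega> \<le> up_ratio n a N (lam, lam * \<theta> ^ k)"
proof -
  define \<psi> where "\<psi> = (\<lambda>v s. act_w lam s * (if length v = N then \<Prod>c\<in>children k v. inter_w \<theta> s (\<omega> c) else 1))"
  define \<psi>' where "\<psi>' = (\<lambda>v s. act_w lam s * (if length v = N then \<Prod>c\<in>children k v. inter_w \<theta> s e else 1))"
  have e: "e \<in> spins" using e_cases by (auto simp: spins_def)
  have "spec_kernel k \<theta> lam (ball_n k N) (up_event n a) \<omega> =
      tree_Z k \<theta> N (\<lambda>v s. \<psi> v s * up_ind n a v s) / tree_Z k \<theta> N \<psi>"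
    unfolding \<psi>_def by (rule spec_kernel_up_event[OF \<omega> n(1)])
  also have "\<dots> \<le> tree_Z k \<theta> N (\<lambda>v s. \<psi>' v s * up_ind n a v s) / tree_Z k \<theta> N \<psi>'"
  proof (rule tree_Z_ratio_mono)
    show "\<psi> v s > 0" "\<psi>' v s > 0" for v s
      by (auto simp: \<psi>_def \<psi>'_def act_w_pos inter_w_pos intro!: mult_pos_pos prod_pos)
    fix v
    have "mlr e (\<lambda>s. inter_w \<theta> s (\<omega> c)) (\<lambda>s. inter_w \<theta> s e)" if "c \<in> children k v" for c
    proof -
      have c: "\<omega> c \<in> spins" using that config_in_spins[OF \<omega>] by (auto simp: children_def)
      moreover have "e * \<omega> c \<le> e * e" using c e_cases by (auto simp: spins_def)
      ultimately show ?thesis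
        using mlr_inter_w[of "\<omega> c" e] e by (simp add: inter_w_commute[of _ "\<omega> c"] inter_w_commute[of _ e])
    qed
    then have "mlr e (\<lambda>s. act_w lam s * (\<Prod>c\<in>children k v. inter_w \<theta> s (\<omega> c)))
        (\<lambda>s. act_w lam s * (\<Prod>c\<in>children k v. inter_w \<theta> s e))"
      by (intro mlr_mult mlr_prod mlr_refl prod_nonneg) (simp_all add: act_w_pos inter_w_pos less_imp_le)
    then show "mlr e (\<psi> v) (\<psi>' v)"
      by (cases "length v = N") (simp_all add: \<psi>_def \<psi>'_def mlr_refl)
  qed (auto simp: incr_up_ind)
  also have "\<dots> = up_ratio n a N (lam, lam * \<theta> ^ k)"
  proof -
    have "\<psi>' v s = mess (lam, lam * \<theta> ^ k) N v s" if "v \<in> ball_n k N" "s \<in> spins" for v s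
    proof (cases "length v = N")
      case True
      \<comment> \<open>\<open>1 \<le> N\<close> keeps the root off the last level.\<close>
      then have "card (children k v) = k"
        using that n by (intro card_children) (auto simp: ball_n_def)
      then show ?thesis
        using that True e_cases by (auto simp: \<psi>'_def mess_def spins_def inter_w_def act_w_def bl_def)
    qed (use that in \<open>auto simp: \<psi>'_def mess_def ball_n_def\<close>)
    then show ?thesis
      unfolding up_ratio_def by (intro arg_cong2[where f = "(/)"] tree_Z_cong) auto
  qed
  finally show ?thesis .
qed

text \<open>The factor pulled out is the k-th power of the message at spin 0, which restores the
  normalisation there.\<close>

lemma msg_bl:
  assumes "s \<in> spins" "0 < fst p" "0 < snd p"
  shows "act_w lam s * msg \<theta> (\<lambda>t. bl (fst p) (snd p) (e * t)) s ^ k =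
    (1 + fst p + snd p) ^ k * bl (fst (bl_step k \<theta> lam p)) (snd (bl_step k \<theta> lam p)) (e * s)"
proof -
  have S: "1 + fst p + snd p \<noteq> 0" using assms by simp
  then show ?thesis
    using assms(1) e_cases
    by (auto simp: spins_def msg_def inter_w_def act_w_def bl_def bl_step_def power_divide algebra_simps)
qed

text \<open>The event lives in the smaller ball, so the new leaves carry no indicator; summing them
  out applies the boundary law map, and the normalising constants cancel in the quotient.\<close>

lemma up_ratio_Suc:
  assumes "n \<le> N" "1 \<le> N" "0 < fst p" "0 < snd p"
  shows "up_ratio n a (Suc N) p = up_ratio n a N (bl_step k \<theta> lam p)"
proof -
  define c where "c v = (if length v = N then (1 + fst p + snd p) ^ k else 1)" for v :: "nat list"
  have Z: "tree_Z k \<theta> (Suc N) (\<lambda>v s. mess p (Suc N) v s * h v s) =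
      (\<Prod>v\<in>ball_n k N. c v) * tree_Z k \<theta> N (\<lambda>v s. mess (bl_step k \<theta> lam p) N v s * h v s)"
    if h: "\<And>v s. length v = Suc N \<Longrightarrow> h v s = 1" for h
  proof -
    have "absorb k \<theta> N (\<lambda>v s. mess p (Suc N) v s * h v s) v s =
        c v * (mess (bl_step k \<theta> lam p) N v s * h v s)" if v: "v \<in> ball_n k N" "s \<in> spins" for v s
    proof (cases "length v = N")
      case True
      have "card (children k v) = k"
        using v assms True by (intro card_children) (auto simp: ball_n_def)
      moreover have "(\<lambda>s. mess p (Suc N) w s * h w s) = (\<lambda>t. bl (fst p) (snd p) (e * t))"
        if "w \<in> children k v" for w
      proof -
        have "length w = Suc N" using that True by (auto simp: children_def)
        then show ?thesis by (simp add: mess_def h)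
      qed
      ultimately have "absorb k \<theta> N (\<lambda>v s. mess p (Suc N) v s * h v s) v s =
          (act_w lam s * msg \<theta> (\<lambda>t. bl (fst p) (snd p) (e * t)) s ^ k) * h v s"
        using True by (simp add: absorb_def mess_def mult_ac)
      then show ?thesis
        unfolding msg_bl[OF v(2) assms(3,4)] using True by (simp add: c_def mess_def mult_ac)
    qed (use v in \<open>auto simp: absorb_def mess_def c_def ball_n_def\<close>)
    then have "tree_Z k \<theta> N (absorb k \<theta> N (\<lambda>v s. mess p (Suc N) v s * h v s)) =
        tree_Z k \<theta> N (\<lambda>v s. c v * (mess (bl_step k \<theta> lam p) N v s * h v s))"
      by (rule tree_Z_cong)
    then show ?thesis by (simp add: tree_Z_Suc tree_Z_scale)
  qed
  have "c v \<noteq> 0" for v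
    using assms by (auto simp: c_def)
  moreover have "up_ind n a v s = 1" if "length v = Suc N" for v s
    using that assms by (auto simp: up_ind_def ball_n_def)
  ultimately show ?thesis
    using Z[of "up_ind n a"] Z[of "\<lambda>_ _. 1"] by (simp add: up_ratio_def)
qed

section \<open>Passage to infinite volume\<close>

lemma bl_step_iterate_pos:
  "0 < fst p \<Longrightarrow> 0 < snd p \<Longrightarrow>
    0 < fst ((bl_step k \<theta> lam ^^ j) p) \<and> 0 < snd ((bl_step k \<theta> lam ^^ j) p)"
proof (induction j)
  case (Suc j)
  let ?q = "(bl_step k \<theta> lam ^^ j) p"
  have "0 < lam * \<theta> ^ k" using lam_pos \<theta>_pos by simp
  then show ?case
    using Suc bl_step_bounds[OF \<theta>_pos \<theta>_less lam_pos, of ?q k] by fastforce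
qed simp

lemma up_ratio_iterate:
  assumes "1 \<le> n" "0 < fst p" "0 < snd p"
  shows "up_ratio n a (n + j) p = up_ratio n a n ((bl_step k \<theta> lam ^^ j) p)"
  using assms(2,3)
proof (induction j arbitrary: p)
  case (Suc j)
  have "up_ratio n a (n + Suc j) p = up_ratio n a (n + j) (bl_step k \<theta> lam p)"
    using up_ratio_Suc[of n "n + j" p a] assms(1) Suc.prems by simp
  also have "\<dots> = up_ratio n a n ((bl_step k \<theta> lam ^^ j) (bl_step k \<theta> lam p))"
    using bl_step_iterate_pos[of p 1] Suc.prems by (intro Suc.IH) auto
  finally show ?case by (simp add: funpow_swap1)
qed simp

text \<open>In a fixed volume the quotient is a rational function of the message, with positive
  denominator at p.\<close>

lemma up_ratio_tendsto:
  assumes "(\<lambda>j. fst (P j)) \<longlonglongrightarrow> fst p" "(\<lambda>j. snd (P j)) \<longlonglongrightarrow> snd p" "0 < fst p" "0 < snd p"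
  shows "(\<lambda>j. up_ratio n a N (P j)) \<longlonglongrightarrow> up_ratio n a N p"
proof -
  have mess: "(\<lambda>j. mess (P j) N v s) \<longlonglongrightarrow> mess p N v s" for v s
    using assms by (auto simp: mess_def bl_def)
  have "tree_Z k \<theta> N (mess p N) > 0"
    using assms by (intro tree_Z_pos mess_pos)
  then show ?thesis
    unfolding up_ratio_def tree_Z_def tree_weight_def
    by (intro tendsto_divide tendsto_sum tendsto_mult tendsto_prod tendsto_const mess)
      (simp add: tree_Z_def tree_weight_def)
qed

text \<open>The kernel bound is uniform in the boundary condition, so it survives integration over
  \<nu>. Radius n + j becomes j iterations at radius n, and j tends to infinity.\<close>

lemma gibbs_up_event_le:
  assumes k: "k \<in> {2, 3}" and fp: "bl_step k \<theta> lam (X, Y) = (X, Y)" and XY: "0 < Y" "Y < X"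
    and \<nu>: "is_gibbs k \<theta> lam \<nu>" and n: "1 \<le> n"
  shows "measure \<nu> (up_event n a) \<le> up_ratio n a n (X, Y)"
proof -
  have P: "prob_space \<nu>" and S: "sets \<nu> = sets (config_space k)" using \<nu> by (auto simp: is_gibbs_def)
  interpret prob_space \<nu> by fact
  have sp: "space \<nu> = space (config_space k)" by (rule sets_eq_imp_space_eq[OF S])
  have dlr: "measure \<nu> (A \<inter> B) = set_lebesgue_integral \<nu> B (spec_kernel k \<theta> lam \<Lambda> A)"
    if "finite \<Lambda>" "\<Lambda> \<subseteq> cayley_V k" "A \<in> sets (config_space k)" "B \<in> outer_sets k \<Lambda>" for \<Lambda> A B
    using \<nu> that unfolding is_gibbs_def by blast
  let ?p = "(lam, lam * \<theta> ^ k)"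
  have bound: "measure \<nu> (up_event n a) \<le> up_ratio n a n ((bl_step k \<theta> lam ^^ j) ?p)" for j
  proof -
    let ?\<Lambda> = "ball_n k (n + j)"
    have "space (config_space k) \<in> outer_sets k ?\<Lambda>"
      unfolding outer_sets_def
      using sets.top[of "vimage_algebra (space (config_space k)) (\<lambda>\<omega>. restrict \<omega> (cayley_V k - ?\<Lambda>))
        (PiM (cayley_V k - ?\<Lambda>) (\<lambda>_. count_space spins))"] by simp
    then have "measure \<nu> (up_event n a \<inter> space (config_space k)) =
        set_lebesgue_integral \<nu> (space (config_space k)) (spec_kernel k \<theta> lam ?\<Lambda> (up_event n a))"
      by (intro dlr finite_ball_n ball_n_subset up_event_sets)
    moreover have "up_event n a \<inter> space (config_space k) = up_event n a"
      by (auto simp: up_event_def)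
    moreover have "set_lebesgue_integral \<nu> (space (config_space k)) (spec_kernel k \<theta> lam ?\<Lambda> (up_event n a)) =
        (\<integral>\<omega>. spec_kernel k \<theta> lam ?\<Lambda> (up_event n a) \<omega> \<partial>\<nu>)"
      unfolding set_lebesgue_integral_def by (intro Bochner_Integration.integral_cong) (auto simp: sp)
    ultimately have "measure \<nu> (up_event n a) = (\<integral>\<omega>. spec_kernel k \<theta> lam ?\<Lambda> (up_event n a) \<omega> \<partial>\<nu>)"
      by simp
    also have "\<dots> \<le> (\<integral>\<omega>. up_ratio n a (n + j) ?p \<partial>\<nu>)"
    proof (rule integral_mono')
      fix \<omega> assume "\<omega> \<in> space \<nu>"
      then have \<omega>: "\<omega> \<in> space (config_space k)" by (simp add: sp)
      show "spec_kernel k \<theta> lam ?\<Lambda> (up_event n a) \<omega> \<le> up_ratio n a (n + j) ?p"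
        using n by (intro spec_kernel_up_event_le \<omega>) auto
      have "0 \<le> spec_kernel k \<theta> lam ?\<Lambda> (up_event n a) \<omega>"
        unfolding spec_kernel_eq by (intro sum_nonneg mult_nonneg_nonneg) (auto simp: kprob_pos less_imp_le)
      also have "\<dots> \<le> up_ratio n a (n + j) ?p"
        using n by (intro spec_kernel_up_event_le \<omega>) auto
      finally show "0 \<le> up_ratio n a (n + j) ?p" .
    qed simp
    also have "\<dots> = up_ratio n a n ((bl_step k \<theta> lam ^^ j) ?p)"
      using n lam_pos \<theta>_pos by (simp add: up_ratio_iterate prob_space)
    finally show ?thesis .
  qed
  have "(\<lambda>j. up_ratio n a n ((bl_step k \<theta> lam ^^ j) ?p)) \<longlonglongrightarrow> up_ratio n a n (X, Y)"
    using bl_step_iterates_tendsto[OF k \<theta>_pos \<theta>_less lam_pos fp XY] XY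
    by (intro up_ratio_tendsto) auto
  then show ?thesis
    by (rule LIMSEQ_le_const) (use bound in auto)
qed

text \<open>The bound is attained, since the ball marginals of the measure are tree measures with
  boundary message (X, Y).\<close>

lemma tisgm_up_event:
  assumes \<mu>: "tisgm_of k \<theta> lam x y \<mu>" and n: "1 \<le> n"
    and XY: "(X, Y) = (if e = 1 then (x, y) else (y, x))"
  shows "measure \<mu> (up_event n a) = up_ratio n a n (X, Y)"
proof -
  have P: "prob_space \<mu>" and S: "sets \<mu> = sets (config_space k)" using \<mu> by (auto simp: tisgm_of_def)
  let ?\<Omega> = "PiE (ball_n k n) (\<lambda>_. spins)"
  have "tree_weight k \<theta> n (\<lambda>v s. if length v < n then act_w lam s else bl x y s) \<sigma> =
      tree_weight k \<theta> n (mess (X, Y) n) \<sigma>" if "\<sigma> \<in> ?\<Omega>" for \<sigma>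
  proof -
    have "bl x y s = bl X Y (e * s)" if "s \<in> spins" for s
      using that XY e_cases by (auto simp: bl_def spins_def)
    then show ?thesis
      using that unfolding tree_weight_def
      by (intro arg_cong2[where f = "(*)"] prod.cong) (auto simp: mess_def PiE_iff)
  qed
  then have w: "tisgm_weight k \<theta> lam x y n \<sigma> = tree_weight k \<theta> n (mess (X, Y) n) \<sigma>" if "\<sigma> \<in> ?\<Omega>" for \<sigma>
    using that by (simp add: tisgm_weight_eq)
  have cyl: "measure \<mu> (cyl k n \<sigma>) = tree_weight k \<theta> n (mess (X, Y) n) \<sigma> / tree_Z k \<theta> n (mess (X, Y) n)"
    if "\<sigma> \<in> ?\<Omega>" for \<sigma>
    using \<mu> n that w by (simp add: tisgm_of_def cyl_def tree_Z_def)
  have "up_event n a = {\<omega> \<in> space (config_space k). \<forall>v\<in>ball_n k n. a v \<le> e * restrict \<omega> (ball_n k n) v}"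
    by (auto simp: up_event_def)
  then have "measure \<mu> (up_event n a) = (\<Sum>\<sigma>\<in>{\<sigma> \<in> ?\<Omega>. \<forall>v\<in>ball_n k n. a v \<le> e * \<sigma> v}. measure \<mu> (cyl k n \<sigma>))"
    using measure_ball_event[OF P S, where Q = "\<lambda>\<sigma>. \<forall>v\<in>ball_n k n. a v \<le> e * \<sigma> v" and n = n] by simp
  also have "\<dots> = (\<Sum>\<sigma>\<in>?\<Omega>. if \<forall>v\<in>ball_n k n. a v \<le> e * \<sigma> v then measure \<mu> (cyl k n \<sigma>) else 0)"
    by (rule sum.inter_filter) simp
  also have "\<dots> = (\<Sum>\<sigma>\<in>?\<Omega>. tree_weight k \<theta> n (\<lambda>v s. mess (X, Y) n v s * up_ind n a v s) \<sigma> /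
      tree_Z k \<theta> n (mess (X, Y) n))"
    by (intro sum.cong refl) (simp add: cyl tree_weight_mult prod_up_ind)
  finally show ?thesis
    by (simp add: up_ratio_def tree_Z_def sum_divide_distrib)
qed

text \<open>Thresholds are turned into prescribed values one site at a time, since
  \<open>{e * \<omega> v = c} = {e * \<omega> v \<ge> c} - {e * \<omega> v \<ge> c + 1}\<close>.\<close>

lemma measure_eq_if_up_events_eq:
  assumes P: "prob_space M" "prob_space N" and S: "sets M = sets (config_space k)" "sets N = sets (config_space k)"
    and eq: "\<And>n a. 1 \<le> n \<Longrightarrow> measure M (up_event n a) = measure N (up_event n a)"
  shows "M = N"
proof (rule measure_eqI_cyl[OF P S])
  fix n :: nat and \<sigma> assume n: "1 \<le> n"
  interpret M: prob_space M by fact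
  interpret N: prob_space N by fact
  \<comment> \<open>Interpolates between threshold events (J empty) and cylinders (J the whole
    ball).\<close>
  define C where "C J a = {\<omega> \<in> space (config_space k).
    \<forall>v\<in>ball_n k n. if v \<in> J then e * \<omega> v = a v else a v \<le> e * \<omega> v}" for J a
  have C_sets: "C J a \<in> sets (config_space k)" for J a
    unfolding C_def by (rule ball_event_sets[where P = "\<lambda>v s. if v \<in> J then e * s = a v else a v \<le> e * s"])
  \<comment> \<open>The claim ranges over all a because the induction step shifts the threshold at
    u.\<close>
  have "\<forall>a. measure M (C J a) = measure N (C J a)" if "finite J" "J \<subseteq> ball_n k n" for J
    using that
  proof (induction J rule: finite_induct)
    case empty
    show ?case using eq[OF n] by (simp add: C_def up_event_def)
  next
    case (insert u J)
    show ?case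
    proof
      fix a
      have u: "u \<in> ball_n k n" "u \<notin> J" using insert by auto
      have sub: "C J (a(u := a u + 1)) \<subseteq> C J a"
        using u by (fastforce simp: C_def split: if_splits)
      have diff: "C (insert u J) a = C J a - C J (a(u := a u + 1))"
      proof (intro set_eqI iffI)
        fix \<omega> assume \<omega>: "\<omega> \<in> C (insert u J) a"
        then have "e * \<omega> u = a u" using u by (auto simp: C_def)
        moreover have "\<omega> \<in> C J a" using \<omega> u by (fastforce simp: C_def split: if_splits)
        ultimately show "\<omega> \<in> C J a - C J (a(u := a u + 1))" using u by (force simp: C_def)
      next
        fix \<omega> assume \<omega>: "\<omega> \<in> C J a - C J (a(u := a u + 1))"
        then have 1: "\<omega> \<in> space (config_space k)"
          "\<forall>v\<in>ball_n k n. if v \<in> J then e * \<omega> v = a v else a v \<le> e * \<omega> v" by (auto simp: C_def)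
        obtain v where "v \<in> ball_n k n"
          "\<not> (if v \<in> J then e * \<omega> v = (a(u := a u + 1)) v else (a(u := a u + 1)) v \<le> e * \<omega> v)"
          using \<omega> 1(1) by (auto simp: C_def)
        with 1 u have "v = u" "\<not> a u + 1 \<le> e * \<omega> u" by (auto split: if_splits)
        moreover have "a u \<le> e * \<omega> u" using 1 u by auto
        ultimately have "e * \<omega> u = a u" by simp
        then show "\<omega> \<in> C (insert u J) a" using 1 by (auto simp: C_def)
      qed
      have "measure M (C (insert u J) a) = measure M (C J a) - measure M (C J (a(u := a u + 1)))"
        unfolding diff using C_sets sub by (intro M.finite_measure_Diff) (auto simp: S)
      moreover have "measure N (C (insert u J) a) = measure N (C J a) - measure N (C J (a(u := a u + 1)))"
        unfolding diff using C_sets sub by (intro N.finite_measure_Diff) (auto simp: S)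
      moreover have "measure M (C J b) = measure N (C J b)" for b
        using insert by blast
      ultimately show "measure M (C (insert u J) a) = measure N (C (insert u J) a)"
        by (simp only:)
    qed
  qed
  then have "measure M (C (ball_n k n) (\<lambda>v. e * \<sigma> v)) = measure N (C (ball_n k n) (\<lambda>v. e * \<sigma> v))"
    by simp
  moreover have "C (ball_n k n) (\<lambda>v. e * \<sigma> v) = cyl k n \<sigma>"
    using e_cases by (auto simp: C_def cyl_def)
  ultimately show "measure M (cyl k n \<sigma>) = measure N (cyl k n \<sigma>)" by simp
qed

text \<open>Both gaps to the maximum are nonnegative and their weighted sum vanishes, so each gap is
  zero.\<close>

lemma extreme_gibbs_if_maximal:
  assumes \<mu>: "is_gibbs k \<theta> lam \<mu>"
    and max: "\<And>\<nu> n a. is_gibbs k \<theta> lam \<nu> \<Longrightarrow> 1 \<le> n \<Longrightarrow> measure \<nu> (up_event n a) \<le> measure \<mu> (up_event n a)"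
  shows "extreme_gibbs k \<theta> lam \<mu>"
  unfolding extreme_gibbs_def
proof (intro conjI allI impI \<mu>)
  fix \<mu>1 \<mu>2 and t :: real
  assume *: "is_gibbs k \<theta> lam \<mu>1 \<and> is_gibbs k \<theta> lam \<mu>2 \<and> 0 < t \<and> t < 1 \<and>
    (\<forall>A\<in>sets (config_space k). measure \<mu> A = t * measure \<mu>1 A + (1 - t) * measure \<mu>2 A)"
  have eq: "measure \<mu>1 (up_event n a) = measure \<mu> (up_event n a) \<and>
      measure \<mu>2 (up_event n a) = measure \<mu> (up_event n a)" if n: "1 \<le> n" for n a
  proof -
    let ?m = "measure \<mu> (up_event n a)" and ?m1 = "measure \<mu>1 (up_event n a)" and ?m2 = "measure \<mu>2 (up_event n a)"
    have "t * (?m - ?m1) + (1 - t) * (?m - ?m2) = 0"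
      using * up_event_sets[of n a] by (simp add: algebra_simps)
    moreover have "0 \<le> t * (?m - ?m1)" "0 \<le> (1 - t) * (?m - ?m2)"
      using * max[of \<mu>1 n a] max[of \<mu>2 n a] n by auto
    ultimately have "t * (?m - ?m1) = 0" "(1 - t) * (?m - ?m2) = 0" by linarith+
    then show ?thesis using * by auto
  qed
  show "\<mu>1 = \<mu>" "\<mu>2 = \<mu>"
    using * \<mu> eq by (auto simp: is_gibbs_def intro!: measure_eq_if_up_events_eq)
qed

end

theorem mainTheorem17:
  fixes k :: nat and \<theta> lam x y :: real and \<mu> :: "(nat list \<Rightarrow> int) measure"
  assumes "k \<in> {2, 3}"
    and "0 < \<theta>" and "\<theta> < theta_c k"
    and "lam > lambda_cr k \<theta>"
    and "x > 0" and "y > 0"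
    and "x = lam * ((1 + x + \<theta> * y) / (1 + x + y)) ^ k"
    and "y = lam * ((1 + \<theta> * x + y) / (1 + x + y)) ^ k"
    and "x \<noteq> y"
    and "tisgm_of k \<theta> lam x y \<mu>"
  shows "extreme_gibbs k \<theta> lam \<mu>"
proof -
  have \<theta>: "\<theta> < 1" using assms(1,3) by (auto simp: theta_c_def)
  have "0 < lambda_cr k \<theta>"
    using assms(1,3) by (auto simp: lambda_cr_def theta_c_def)
  then have lam: "0 < lam" using assms(4) by simp
  \<comment> \<open>The top of the order is chosen as the spin with the larger boundary law
    value.\<close>
  define e :: int where "e = (if y < x then 1 else - 1)"
  define X Y where "X = max x y" and "Y = min x y"
  interpret scwr k \<theta> lam e
    by standard (use assms \<theta> lam in \<open>auto simp: e_def\<close>)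
  have XY: "(X, Y) = (if e = 1 then (x, y) else (y, x))"
    by (auto simp: e_def X_def Y_def)
  have fp: "bl_step k \<theta> lam (x, y) = (x, y)"
    unfolding bl_step_def using assms(7,8) by simp
  \<comment> \<open>The global spin flip exchanges the two equations.\<close>
  moreover have "bl_step k \<theta> lam (y, x) = (y, x)"
    using fp by (simp add: bl_step_def add_ac)
  ultimately have "bl_step k \<theta> lam (X, Y) = (X, Y)"
    using XY by (simp split: if_splits)
  then show ?thesis
    using gibbs_up_event_le[OF assms(1), of X Y] tisgm_up_event[OF assms(10) _ XY] assms(5,6,9)
    by (intro extreme_gibbs_if_maximal tisgm_is_gibbs[OF assms(10)]) (auto simp: X_def Y_def)
qed

end
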